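(* Let $\Sigma\subseteq\mathrm{PG}(4,q^5)$ be a canonical $\mathbb F_q$-subgeometry and $\Gamma$ a plane such that $\mathbb L=\wp_\Gamma(\Sigma)$ is a maximum scattered linear set of $\mathrm{PG}(1,q^5)$ not of pseudoregulus type. Let $1\neq\sigma\in\mathbb G$, let $A$ and $B$ be the points $\Gamma\cap\Gamma^{\sigma^4}$ and $\Gamma\cap\Gamma^{\sigma^3}$, and let $E=\langle A,B\rangle\cap\langle A_1,B_2\rangle$ and $F=\langle A,B_2\rangle\cap\langle A_1,B\rangle$. Then $\mathbb L$ is of LP type if and only if $E\in\langle A_2,A_4\rangle$ or $F\in\langle B_3,B_4\rangle$.
   Context: $q$ is a prime power; $\mathrm N_{q^5/q}(x)=x^{1+q+q^2+q^3+q^4}$. An $\mathbb F_q$-linear set of rank 5 in $\mathrm{PG}(1,q^5)$ is $L_U=\{\langle v\rangle_{\mathbb F_{q^5}}:v\in U\setminus\{0\}\}$ for a 5-dimensional $\mathbb F_q$-subspace $U\subseteq\mathbb F_{q^5}^2$; maximum scattered means having $(q^5-1)/(q-1)$ points. Pseudoregulus type: $\mathrm{P\Gamma L}(2,q^5)$-equivalent to $\{\langle(x,x^{q^s})\rangle_{\mathbb F_{q^5}}:x\neq0\}$, $\gcd(s,5)=1$; LP type: equivalent to $\{\langle(x,x^{q^s}+\delta x^{q^{5-s}})\rangle_{\mathbb F_{q^5}}:x\neq0\}$, $\gcd(s,5)=1$, $\mathrm N_{q^5/q}(\delta)\notin\{0,1\}$. A canonical $\mathbb F_q$-subgeometry of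 $\mathrm{PG}(4,q^5)$ is the image under a projectivity of the set of points with coordinates in $\mathbb F_q$; $\Gamma\cap\Sigma=\emptyset$ and $\wp_\Gamma(\Sigma)$ is the projection of $\Sigma$ from $\Gamma$ onto a line disjoint from $\Gamma$. $\mathbb G$ is the subgroup of $\mathrm{P\Gamma L}(5,q^5)$ fixing $\Sigma$ pointwise (cyclic of order 5). Under the hypotheses $\Gamma\cap\Gamma^{\sigma^4}$ and $\Gamma\cap\Gamma^{\sigma^3}$ are single points and $A,A_1,B,B_2$ are four points of $\Gamma$, no three collinear. For a point $X$, $X_i=X^{\sigma^i}$; $\langle\ \rangle$ denotes projective span. *)

theory Defs
  imports
    "HOL-Analysis.Cartesian_Space"
    "HOL-Library.FuncSet"
    "HOL-Number_Theory.Prime_Powers"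
begin

text \<open>
  The field with \<open>q^5\<close> elements is a finite type \<open>'a\<close> of class field with \<open>CARD('a) = q ^ 5\<close>.
  Its subfield with \<open>q\<close> elements is the set of fixed points of \<open>x \<mapsto> x ^ q\<close>.
\<close>

definition Fq :: "nat \<Rightarrow> 'a::field set" where
  "Fq q = {x. x ^ q = x}"

definition norm5 :: "nat \<Rightarrow> 'a::field \<Rightarrow> 'a" where
  "norm5 q x = x ^ (1 + q + q ^ 2 + q ^ 3 + q ^ 4)"

definition field_automorphism :: "('a::field \<Rightarrow> 'a) \<Rightarrow> bool" where
  "field_automorphism \<theta> \<longleftrightarrow>
     bij \<theta> \<and> (\<forall>x y. \<theta> (x + y) = \<theta> x + \<theta> y) \<and> (\<forall>x y. \<theta> (x * y) = \<theta> x * \<theta> y)"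

text \<open>
  The points of the projective space of \<open>'a ^ 'n\<close>, which has projective dimension
  \<open>CARD('n) - 1\<close>, are the one-dimensional subspaces of \<open>'a ^ 'n\<close>. Projective subspaces are sets
  of points, and a collineation is a function on points, so that the image of a subspace
  \<open>X\<close> under a collineation \<open>g\<close> is \<open>g ` X\<close>.
\<close>

definition pg_points :: "('a::field ^ 'n) set set" where
  "pg_points = {vec.span {v} | v. v \<noteq> 0}"

definition pg_subspace :: "nat \<Rightarrow> ('a::field ^ 'n) set set \<Rightarrow> bool" where
  "pg_subspace k X \<longleftrightarrow>
     (\<exists>W. vec.subspace W \<and> vec.dim W = k + 1 \<and> X = {P \<in> pg_points. P \<subseteq> W})"

abbreviation pg_line :: "('a::field ^ 'n) set set \<Rightarrow> bool" where
  "pg_line \<equiv> pg_subspace 1"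

abbreviation pg_plane :: "('a::field ^ 'n) set set \<Rightarrow> bool" where
  "pg_plane \<equiv> pg_subspace 2"

definition pg_span :: "('a::field ^ 'n) set set \<Rightarrow> ('a ^ 'n) set set" where
  "pg_span X = {P \<in> pg_points. P \<subseteq> vec.span (\<Union>X)}"

definition PGL :: "(('a::field ^ 'n) set \<Rightarrow> ('a ^ 'n) set) set" where
  "PGL = {(\<lambda>P\<in>pg_points. (\<lambda>v. M *v v) ` P) | M. invertible M}"

definition semilinear_bij :: "('a::field ^ 'n \<Rightarrow> 'a ^ 'n) \<Rightarrow> bool" where
  "semilinear_bij f \<longleftrightarrow> bij f \<and> (\<forall>u v. f (u + v) = f u + f v) \<and>
     (\<exists>\<theta>. field_automorphism \<theta> \<and> (\<forall>c v. f (c *s v) = \<theta> c *s f v))"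

definition PGammaL :: "(('a::field ^ 'n) set \<Rightarrow> ('a ^ 'n) set) set" where
  "PGammaL = {(\<lambda>P\<in>pg_points. f ` P) | f. semilinear_bij f}"

definition pg_one :: "('a::field ^ 'n) set \<Rightarrow> ('a ^ 'n) set" where
  "pg_one = (\<lambda>P\<in>pg_points. P)"

definition PGammaL_equivalent :: "('a::field ^ 'n) set set \<Rightarrow> ('a ^ 'n) set set \<Rightarrow> bool" where
  "PGammaL_equivalent X Y \<longleftrightarrow> (\<exists>g\<in>PGammaL. g ` X = Y)"

definition pointwise_stabilizer ::
  "('a::field ^ 'n) set set \<Rightarrow> (('a ^ 'n) set \<Rightarrow> ('a ^ 'n) set) set" where
  "pointwise_stabilizer S = {g \<in> PGammaL. \<forall>P\<in>S. g P = P}"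

definition canonical_subgeometry :: "nat \<Rightarrow> ('a::field ^ 'n) set set \<Rightarrow> bool" where
  "canonical_subgeometry q S \<longleftrightarrow>
     (\<exists>g\<in>PGL. S = g ` {vec.span {v} | v. v \<noteq> 0 \<and> (\<forall>i. v $ i \<in> Fq q)})"

definition pg_projection ::
  "('a::field ^ 'n) set set \<Rightarrow> ('a ^ 'n) set set \<Rightarrow> ('a ^ 'n) set set \<Rightarrow> ('a ^ 'n) set set" where
  "pg_projection \<Gamma> \<Lambda> S = {Q. \<exists>P\<in>S. pg_span (insert P \<Gamma>) \<inter> \<Lambda> = {Q}}"

text \<open>
  A projectivity from a projective subspace \<open>X\<close> of one projective space onto the whole of another
  one, used to regard a line of the ambient space as the projective line of \<open>'a ^ 2\<close>.
\<close>

definition pg_coordinates ::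
  "('a::field ^ 'n) set set \<Rightarrow> (('a ^ 'n) set \<Rightarrow> ('a ^ 'm) set) \<Rightarrow> bool" where
  "pg_coordinates X \<kappa> \<longleftrightarrow>
     (\<exists>M :: 'a ^ 'n ^ 'm. inj_on (\<lambda>v. M *v v) (vec.span (\<Union>X)) \<and>
        (\<forall>P\<in>X. \<kappa> P = (\<lambda>v. M *v v) ` P)) \<and>
     \<kappa> ` X = pg_points"

definition Fq_subspace :: "nat \<Rightarrow> ('a::field ^ 'n) set \<Rightarrow> bool" where
  "Fq_subspace q U \<longleftrightarrow>
     0 \<in> U \<and> (\<forall>u\<in>U. \<forall>v\<in>U. u + v \<in> U) \<and> (\<forall>c\<in>Fq q. \<forall>u\<in>U. c *s u \<in> U)"

definition Fq_basis :: "nat \<Rightarrow> ('a::field ^ 'n) set \<Rightarrow> ('a ^ 'n) set \<Rightarrow> bool" where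
  "Fq_basis q B U \<longleftrightarrow> finite B \<and> B \<subseteq> U \<and>
     (\<forall>c. (\<forall>b\<in>B. c b \<in> Fq q) \<and> (\<Sum>b\<in>B. c b *s b) = 0 \<longrightarrow> (\<forall>b\<in>B. c b = 0)) \<and>
     (\<forall>u\<in>U. \<exists>c. (\<forall>b\<in>B. c b \<in> Fq q) \<and> u = (\<Sum>b\<in>B. c b *s b))"

definition linear_set :: "nat \<Rightarrow> nat \<Rightarrow> ('a::field ^ 'n) set set \<Rightarrow> bool" where
  "linear_set q r L \<longleftrightarrow>
     (\<exists>U. Fq_subspace q U \<and> (\<exists>B. Fq_basis q B U \<and> card B = r) \<and>
        L = {vec.span {v} | v. v \<in> U - {0}})"

definition maximum_scattered :: "nat \<Rightarrow> ('a::field ^ 2) set set \<Rightarrow> bool" where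
  "maximum_scattered q L \<longleftrightarrow> linear_set q 5 L \<and> card L = (q ^ 5 - 1) div (q - 1)"

definition pseudoregulus_type :: "nat \<Rightarrow> ('a::field ^ 2) set set \<Rightarrow> bool" where
  "pseudoregulus_type q L \<longleftrightarrow>
     (\<exists>s. coprime s 5 \<and>
        PGammaL_equivalent L {vec.span {vector [x, x ^ (q ^ s)]} | x. x \<noteq> 0})"

text \<open>The condition \<open>s < 5\<close> makes the exponent \<open>5 - s\<close> a genuine subtraction.\<close>

definition LP_type :: "nat \<Rightarrow> ('a::field ^ 2) set set \<Rightarrow> bool" where
  "LP_type q L \<longleftrightarrow>
     (\<exists>s \<delta>. s < 5 \<and> coprime s 5 \<and> norm5 q \<delta> \<notin> {0, 1} \<and>
        PGammaL_equivalent L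
          {vec.span {vector [x, x ^ (q ^ s) + \<delta> * x ^ (q ^ (5 - s))]} | x. x \<noteq> 0})"

end

theory Submission
  imports Defs "HOL-Computational_Algebra.Polynomial"
begin

text \<open>
  Write \<open>\<Gamma>\<close> as the kernel of a linear map \<open>N\<close> onto \<open>'a ^ 2\<close>, and let \<open>T\<close> be a semilinear map that
  induces \<open>\<sigma>\<close> and has the \<open>F_q\<close>-form underlying \<open>\<Sigma>\<close> as its set of fixed vectors, so that the linear
  set consists of the points \<open>\<langle>N v\<rangle>\<close> for fixed \<open>v\<close>.
  The condition \<open>E \<in> \<langle>A\<^sub>2, A\<^sub>4\<rangle>\<close> says that \<open>\<Gamma>\<close> is spanned by \<open>A\<close>, \<open>A\<^sub>1\<close> and a point of \<open>\<langle>A\<^sub>2, A\<^sub>4\<rangle>\<close>. Replacing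
  \<open>\<sigma>\<close> by \<open>\<sigma>\<^sup>2\<close> replaces \<open>A\<close>, \<open>B\<close>, \<open>E\<close> by \<open>B\<close>, \<open>A\<^sub>1\<close>, \<open>F\<close>, so the condition on \<open>F\<close> is the same condition for \<open>\<sigma>\<^sup>2\<close>.

  If the condition holds, scatteredness makes the orbit of \<open>A\<close> a basis. In the corresponding
  coordinates the fixed vectors are \<open>(x, x\<^sup>\<theta>, \<dots>)\<close> and the linear set is visibly given by
  \<open>x\<^sup>\<theta> + \<delta> x\<^sup>\<theta>\<^sup>'\<close> with \<open>\<theta>' = \<theta>\<^sup>4\<close>; the norm of \<open>\<delta>\<close> is not \<open>1\<close> since otherwise the set is not scattered.

  Conversely, if the linear set equals that of \<open>f(x) = x\<^sup>\<theta> + \<delta> x\<^sup>\<theta>\<^sup>'\<close>, the first coordinate identifies the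
  fixed vectors with the field and \<open>N\<close> becomes \<open>x \<mapsto> (x, g(x))\<close> with a linearized polynomial \<open>g\<close>.
  The values \<open>f(x) / x\<close> and \<open>g(x) / x\<close> agree with multiplicities, and comparing the sums over \<open>x\<close> of
  \<open>w\<close>, \<open>w w\<^sup>\<theta>\<close>, \<open>w w\<^sup>\<theta>\<^sup>\<theta>\<close> and \<open>w w\<^sup>\<theta> w\<^sup>\<theta>\<^sup>\<theta>\<close> for \<open>w = f(x) / x\<close> and \<open>w = g(x) / x\<close> shows that \<open>g\<close> has the
  same two terms as \<open>f\<close>. This puts \<open>\<Gamma>\<close> in the required position for \<open>\<theta>\<close>, hence for \<open>\<sigma>\<close> or \<open>\<sigma>\<^sup>2\<close>.
\<close>

subsection \<open>The field with \<open>q ^ 5\<close> elements\<close>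

lemma exists_inverse_mod_5:
  assumes "\<not> (5::nat) dvd m" obtains k where "k * m mod 5 = 1"
proof -
  have "m mod 5 < 5" "m mod 5 \<noteq> 0" using assms by (auto simp: dvd_eq_mod_eq_0)
  then consider "m mod 5 = 1" | "m mod 5 = 2" | "m mod 5 = 3" | "m mod 5 = 4" by linarith
  then show ?thesis
  proof cases
    case 1 then show ?thesis by (intro that[of 1]) auto
  next
    case 2 then show ?thesis by (intro that[of 3]) (simp add: mod_mult_right_eq[symmetric, of _ m])
  next
    case 3 then show ?thesis by (intro that[of 2]) (simp add: mod_mult_right_eq[symmetric, of _ m])
  next
    case 4 then show ?thesis by (intro that[of 4]) (simp add: mod_mult_right_eq[symmetric, of _ m])
  qed
qed

lemma not_dvd_mult_5:
  assumes "\<not> 5 dvd m" "\<not> 5 dvd c" shows "\<not> (5::nat) dvd c * m"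
proof -
  have "prime (5::nat)" by simp
  then show ?thesis using assms prime_dvd_mult_iff[of "5::nat" c m] by blast
qed

lemma sum_lessThan_5: "(\<Sum>i<5. f i) = f 0 + f 1 + f 2 + f 3 + f (4::nat)"
  for f :: "nat \<Rightarrow> 'b::ab_group_add"
  by (simp add: eval_nat_numeral add.assoc)

text \<open>Multiplication by a unit \<open>m\<close> permutes the residues modulo 5, so a sum over
  the Frobenius group can be ordered by the powers of any generator.\<close>

lemma sum_periodic_5:
  fixes f :: "nat \<Rightarrow> 'b::ab_group_add"
  assumes "\<not> 5 dvd m" and per: "\<And>i. f i = f (i mod 5)"
  shows "(\<Sum>i<5. f i) = f 0 + f m + f (2 * m) + f (3 * m) + f (4 * m)"
proof -
  have f: "f (c * m) = f (c * (m mod 5) mod 5)" for c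
    using per[of "c * m"] by (simp add: mod_mult_right_eq)
  have "m mod 5 < 5" "m mod 5 \<noteq> 0" using assms(1) by (auto simp: dvd_eq_mod_eq_0)
  then consider "m mod 5 = 1" | "m mod 5 = 2" | "m mod 5 = 3" | "m mod 5 = 4" by linarith
  then show ?thesis unfolding sum_lessThan_5
    by cases (use f[of 1] f[of 2] f[of 3] f[of 4] in \<open>simp_all add: add_ac numeral_2_eq_2\<close>)
qed

text \<open>Turns the set condition of \<open>fr_triple_sum\<close> into comparisons that
  simplification decides once the indices are numerals.\<close>

lemma set3_eq: "{a, b, c} = {0, 1, 2::nat} \<longleftrightarrow>
  a < 3 \<and> b < 3 \<and> c < 3 \<and> a \<noteq> b \<and> a \<noteq> c \<and> b \<noteq> c"
proof
  assume *: "{a, b, c} = {0, 1, 2}"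
  have "card {a, b, c} = 3" unfolding * by simp
  then have "a \<noteq> b" "a \<noteq> c" "b \<noteq> c" by (auto simp: card_insert_if split: if_splits)
  moreover have "a \<in> {0,1,2}" "b \<in> {0,1,2}" "c \<in> {0,1,2}" unfolding *[symmetric] by auto
  ultimately show "a < 3 \<and> b < 3 \<and> c < 3 \<and> a \<noteq> b \<and> a \<noteq> c \<and> b \<noteq> c" by auto
next
  assume "a < 3 \<and> b < 3 \<and> c < 3 \<and> a \<noteq> b \<and> a \<noteq> c \<and> b \<noteq> c"
  then have "a \<in> {0,1,2}" "b \<in> {0,1,2}" "c \<in> {0,1,2}" "a \<noteq> b" "a \<noteq> c" "b \<noteq> c" by auto
  then show "{a, b, c} = {0, 1, 2}" by auto
qed

section \<open>Powers of the Frobenius map and the subfield with q elements\<close>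

locale quintic_field =
  fixes q :: nat and K :: "'a::{field,finite} itself"
  assumes primepow_q: "primepow q" and card_K: "CARD('a) = q ^ 5"
begin

text \<open>The exponent matters only modulo 5 (\<open>fr_mod\<close>), so the inverse of
  \<open>fr m\<close> can be written \<open>fr (4 * m)\<close> without subtraction.\<close>

definition fr :: "nat \<Rightarrow> 'a \<Rightarrow> 'a" where
  "fr k x = x ^ (q ^ k)"

lemma q_gt_1: "q > 1"
  using primepow_gt_Suc_0[OF primepow_q] by simp

lemma power_card: "(x::'a) ^ (q ^ 5) = x"
proof (cases "x = 0")
  case True
  then show ?thesis using q_gt_1 by (simp add: zero_power)
next
  case False
  \<comment> \<open>Multiplication by \<open>x\<close> permutes the nonzero elements, whose product
    then cancels.\<close>
  have "(\<Prod>y\<in>UNIV-{0}. x * y) = (\<Prod>y\<in>UNIV-{0}. y)"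
    by (rule prod.reindex_bij_witness[of _ "\<lambda>y. y / x" "\<lambda>y. x * y"]) (use False in auto)
  then have "x ^ (CARD('a) - 1) * \<Prod>(UNIV-{0::'a}) = \<Prod>(UNIV-{0})"
    by (simp add: prod.distrib)
  then have "x ^ (CARD('a) - 1) = 1" by simp
  then have "x ^ Suc (CARD('a) - 1) = x" unfolding power_Suc by simp
  also have "Suc (CARD('a) - 1) = q ^ 5" using q_gt_1 by (simp add: card_K)
  finally show ?thesis .
qed

text \<open>Translation by 1 permutes the field, so adding 1 to every element leaves the total sum
  unchanged.\<close>

lemma of_nat_card: "of_nat (q ^ 5) = (0::'a)"
proof -
  have "(\<Sum>x\<in>UNIV. x + 1) = (\<Sum>x\<in>(UNIV::'a set). x)"
    by (rule sum.reindex_bij_witness[of _ "\<lambda>y. y - 1" "\<lambda>y. y + 1"]) auto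
  then show ?thesis by (simp add: sum.distrib card_K)
qed

text \<open>The characteristic divides q^5 and q is a power of a single prime, so q^k is a power of
  the characteristic.\<close>

lemma fr_add: "fr k (x + y) = fr k x + fr k y"
proof -
  have prime_char: "prime CHAR('a)"
    by (rule prime_CHAR_semidom) (simp add: finite_imp_CHAR_pos)
  obtain p n where p: "prime p" "q = p ^ n"
    using primepow_q by (auto simp: primepow_def)
  have "CHAR('a) dvd p ^ (n * 5)"
    using of_nat_card unfolding of_nat_eq_0_iff_char_dvd p(2) power_mult .
  then have "CHAR('a) = p"
    using prime_char p(1) by (metis prime_dvd_power primes_dvd_imp_eq)
  then have "q ^ k = CHAR('a) ^ (n * k)" by (simp add: p(2) power_mult)
  then show ?thesis unfolding fr_def by (rule freshmans_dream'[OF prime_char])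
qed

lemma fr_mult: "fr k (x * y) = fr k x * fr k y"
  and fr_divide: "fr k (x / y) = fr k x / fr k y"
  and fr_1 [simp]: "fr k 1 = 1"
  and fr_id [simp]: "fr 0 x = x"
  and fr_0 [simp]: "fr k 0 = 0"
  and fr_eq_0 [simp]: "fr k x = 0 \<longleftrightarrow> x = 0"
  using q_gt_1 by (auto simp: fr_def power_mult_distrib power_divide)

lemma fr_uminus: "fr k (- x) = - fr k x"
  using fr_add[of k x "-x"] by (simp add: eq_neg_iff_add_eq_0 add.commute)

lemma fr_diff: "fr k (x - y) = fr k x - fr k y"
  using fr_add[of k x "-y"] by (simp add: fr_uminus)

lemma fr_sum: "fr k (sum f X) = (\<Sum>x\<in>X. fr k (f x))"
  by (induction X rule: infinite_finite_induct) (auto simp: fr_add)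

lemma fr_fr: "fr k (fr l x) = fr (k + l) x"
  by (simp add: fr_def power_add mult.commute flip: power_mult)

lemma fr_5 [simp]: "fr 5 x = x"
  by (simp add: fr_def power_card)

lemma fr_Suc_5 [simp]: "fr (Suc (Suc (Suc (Suc (Suc 0))))) x = x"
  using fr_5[of x] by (simp add: eval_nat_numeral del: fr_5)

lemma fr_add_mult_5: "fr (k + 5 * n) x = fr k x"
proof (induction n)
  case (Suc n)
  have "fr (k + 5 * Suc n) x = fr (k + 5 * n) (fr 5 x)"
    unfolding fr_fr by (simp add: algebra_simps)
  then show ?case using Suc by simp
qed auto

lemma fr_mod: "fr k = fr (k mod 5)"
  using fr_add_mult_5[of "k mod 5" "k div 5"] by (auto simp: fun_eq_iff)

lemma fr_cong: "k mod 5 = l mod 5 \<Longrightarrow> fr k = fr l"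
  using fr_mod[of k] fr_mod[of l] by simp

lemma fr_mult_mod: "fr (c * m) = fr (c * (m mod 5) mod 5)"
  by (rule fr_cong) (simp add: mod_mult_right_eq)

lemma fr_inj [simp]: "fr k x = fr k y \<longleftrightarrow> x = y"
  using fr_eq_0[of k "x - y"] by (simp add: fr_diff del: fr_eq_0)

lemma Fq_iff: "(x::'a) \<in> Fq q \<longleftrightarrow> fr 1 x = x"
  by (simp add: Fq_def fr_def)

lemma Fq_fr: "x \<in> Fq q \<Longrightarrow> fr k (x::'a) = x"
proof (induction k)
  case (Suc k)
  have "fr (Suc k) x = fr k (fr 1 x)" by (simp add: fr_fr)
  then show ?case using Suc by (simp add: Fq_iff)
qed auto

lemma fr_iterate_fixed: "fr m x = x \<Longrightarrow> fr (k * m) x = x"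
  by (induction k) (auto simp: fr_fr[symmetric])

text \<open>\<open>fr m\<close> generates the group of Frobenius powers, so \<open>fr 1\<close> is
  one of its iterates.\<close>

lemma Fq_if_fr:
  assumes "\<not> 5 dvd m" "fr m x = x" shows "(x::'a) \<in> Fq q"
proof -
  obtain k where "k * m mod 5 = 1" using exists_inverse_mod_5[OF assms(1)] .
  then have "fr (k * m) x = fr 1 x" using fr_cong[of "k * m" 1] by simp
  then show ?thesis using fr_iterate_fixed[OF assms(2)] by (simp add: Fq_iff)
qed

text \<open>Both the exponent of the norm and the number of points of a maximum scattered
  set.\<close>

definition norm_exp :: nat where
  "norm_exp = 1 + q + q ^ 2 + q ^ 3 + q ^ 4"

lemma norm_exp: "(q - 1) * norm_exp = q ^ 5 - 1" "(q ^ 5 - 1) div (q - 1) = norm_exp"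
proof -
  have "(q - 1) * norm_exp + norm_exp = q * norm_exp"
    using q_gt_1 by (cases q) (auto simp: algebra_simps)
  also have "\<dots> = norm_exp + q ^ 5 - 1"
    by (simp add: norm_exp_def algebra_simps power_numeral_reduce)
  finally show *: "(q - 1) * norm_exp = q ^ 5 - 1" using q_gt_1 by simp
  show "(q ^ 5 - 1) div (q - 1) = norm_exp"
    using *[symmetric] q_gt_1 by simp
qed

text \<open>On the nonzero elements, raising to the power q - 1 has at most \<open>norm_exp\<close>
  values, all roots of x^norm_exp = 1, and no fibre exceeds the set of (q-1)-th roots of unity.
  Counting forces at least q - 1 such roots, and the degree bound allows no more.\<close>

lemma card_Fq: "card (Fq q :: 'a set) = q"
proof -
  let ?U = "UNIV - {0::'a}" and ?f = "\<lambda>x::'a. x ^ (q - 1)"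
  have roots: "card {x::'a. x ^ n = 1} \<le> n" if "n > 0" for n
  proof -
    let ?p = "monom 1 n - 1 :: 'a poly"
    have "degree ?p \<le> n" by (intro degree_diff_le) (auto simp: degree_monom_eq)
    moreover have "?p \<noteq> 0"
    proof
      assume "?p = 0"
      then have "coeff ?p n = 0" by simp
      then show False using that by (simp add: one_pCons coeff_pCons split: nat.splits)
    qed
    ultimately have "card {x. poly ?p x = 0} \<le> n"
      using card_poly_roots_bound[of ?p] by linarith
    then show ?thesis by (simp add: poly_monom)
  qed
  have Fq_eq: "Fq q = insert 0 {x::'a. x ^ (q - 1) = 1}"
  proof -
    have "x ^ q = x * x ^ (q - 1)" for x :: 'a
      using q_gt_1 by (metis power_eq_if not_one_less_zero)
    then show ?thesis using q_gt_1 by (auto simp: Fq_def)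
  qed
  have ne: "q - 1 \<noteq> 0" "norm_exp > 0" using q_gt_1 by (auto simp: norm_exp_def)
  have card_fibre: "card {x \<in> ?U. ?f x = y} \<le> card {x::'a. x ^ (q - 1) = 1}" if "y \<in> ?f ` ?U" for y
  proof -
    from that obtain z where z: "z \<in> ?U" "y = z ^ (q - 1)" by (elim imageE)
    have "inj_on (\<lambda>x. x / z) {x \<in> ?U. ?f x = y}" using z by (auto simp: inj_on_def)
    moreover have "(\<lambda>x. x / z) ` {x \<in> ?U. ?f x = y} \<subseteq> {x::'a. x ^ (q - 1) = 1}"
      using z by (auto simp: power_divide)
    ultimately show ?thesis by (intro card_inj_on_le) auto
  qed
  have "q ^ 5 - 1 = card ?U" by (simp add: card_K)
  also have "\<dots> = (\<Sum>y\<in>?f ` ?U. card {x \<in> ?U. ?f x = y})"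
    using sum.image_gen[of ?U "\<lambda>_. 1::nat" ?f] by simp
  also have "\<dots> \<le> (\<Sum>y\<in>?f ` ?U. card {x::'a. x ^ (q - 1) = 1})"
    by (intro sum_mono card_fibre)
  also have "\<dots> = card (?f ` ?U) * card {x::'a. x ^ (q - 1) = 1}" by simp
  also have "\<dots> \<le> norm_exp * card {x::'a. x ^ (q - 1) = 1}"
  proof (intro mult_right_mono)
    have "?f ` ?U \<subseteq> {x. x ^ norm_exp = 1}"
    proof clarsimp
      fix x :: 'a assume "x \<noteq> 0"
      have "Suc (q ^ 5 - 1) = q ^ 5" using q_gt_1 by simp
      then have "x * x ^ (q ^ 5 - 1) = x" using power_card[of x] by (metis power_Suc)
      then have "x ^ (q ^ 5 - 1) = 1" using \<open>x \<noteq> 0\<close> by simp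
      then show "(x ^ (q - Suc 0)) ^ norm_exp = 1"
        unfolding norm_exp(1)[symmetric] power_mult by simp
    qed
    then have "card (?f ` ?U) \<le> card {x::'a. x ^ norm_exp = 1}" by (intro card_mono) auto
    also have "\<dots> \<le> norm_exp" by (rule roots) fact
    finally show "card (?f ` ?U) \<le> norm_exp" .
  qed auto
  finally have "norm_exp * (q - 1) \<le> norm_exp * card {x::'a. x ^ (q - 1) = 1}"
    unfolding norm_exp(1)[symmetric] by (simp only: mult.commute)
  then have "q - 1 \<le> card {x::'a. x ^ (q - 1) = 1}" using ne(2) by simp
  then have "card {x::'a. x ^ (q - 1) = 1} = q - 1" using roots[of "q - 1"] ne by simp
  then show ?thesis unfolding Fq_eq using ne q_gt_1 by (simp add: zero_power)
qed

lemma fr_nontrivial: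
  assumes "\<not> 5 dvd m" obtains c :: 'a where "fr m c \<noteq> c"
proof -
  have "card (Fq q :: 'a set) \<noteq> CARD('a)"
    using q_gt_1 by (simp add: card_Fq card_K power_numeral_reduce)
  then have "\<exists>c::'a. c \<notin> Fq q" by (metis UNIV_eq_I)
  then show ?thesis using that Fq_if_fr[OF assms] by blast
qed

subsection \<open>Character sums\<close>

text \<open>Substituting \<open>c * x\<close> for \<open>x\<close> multiplies the sum by
  \<open>\<psi> c\<close>, which is not 1.\<close>

lemma char_sum:
  fixes \<psi> :: "'a \<Rightarrow> 'a"
  assumes "\<And>x y. \<psi> (x * y) = \<psi> x * \<psi> y" "c \<noteq> 0" "\<psi> c \<noteq> 1"
  shows "(\<Sum>x\<in>UNIV-{0}. \<psi> x) = 0"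
proof -
  have "(\<Sum>x\<in>UNIV-{0}. \<psi> (c * x)) = (\<Sum>x\<in>UNIV-{0}. \<psi> x)"
    by (rule sum.reindex_bij_witness[of _ "\<lambda>y. y / c" "\<lambda>y. c * y"]) (use assms in auto)
  then have "(\<psi> c - 1) * (\<Sum>x\<in>UNIV-{0}. \<psi> x) = 0"
    by (simp add: assms(1) left_diff_distrib flip: sum_distrib_left)
  then show ?thesis using assms(3) by simp
qed

lemma sum_1: "(\<Sum>x\<in>UNIV-{0::'a}. 1::'a) = -1"
proof -
  have "of_nat (q ^ 5 - 1) = (of_nat (q ^ 5) - 1 :: 'a)" using q_gt_1 by (subst of_nat_diff) auto
  then show ?thesis using of_nat_card by (simp add: card_K)
qed

text \<open>The quotient is a multiplicative character of the nonzero elements. If it is trivial,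
  the sum is q^5 - 1, which is -1 in the field.\<close>

lemma fr_orthogonal:
  "(\<Sum>x\<in>UNIV-{0}. fr i x / fr j x) = (if i mod 5 = j mod 5 then -1 else 0)"
proof (cases "i mod 5 = j mod 5")
  case True
  then have "fr i = fr j" by (rule fr_cong)
  then have "(\<Sum>x\<in>UNIV-{0}. fr i x / fr j x) = (\<Sum>x\<in>UNIV-{0::'a}. 1)"
    by (intro sum.cong) auto
  then show ?thesis using True by (simp only: sum_1) auto
next
  case False
  \<comment> \<open>Adding 5 keeps the subtraction of naturals from being cut off at 0.\<close>
  define d where "d = i mod 5 + 5 - j mod 5"
  have lt: "i mod 5 < 5" "j mod 5 < 5" by auto
  have "\<not> 5 dvd d"
  proof
    assume "5 dvd d"
    then obtain k where "d = 5 * k" by (auto elim: dvdE)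
    then have "k = 1" using lt False unfolding d_def by linarith
    then show False using \<open>d = 5 * k\<close> lt False unfolding d_def by linarith
  qed
  then obtain c where c: "fr d c \<noteq> c" using fr_nontrivial by blast
  have "(d + j) mod 5 = (d + j mod 5) mod 5" by (simp add: mod_add_right_eq)
  also have "d + j mod 5 = i mod 5 + 5" using lt by (simp add: d_def)
  finally have "(d + j) mod 5 = i mod 5" by simp
  then have "fr i c = fr d (fr j c)" using fr_cong by (metis fr_fr)
  also have "\<dots> = fr j (fr d c)" by (simp add: fr_fr add.commute)
  also have "\<dots> \<noteq> fr j c" using c by simp
  finally have *: "fr i c \<noteq> fr j c" .
  then have "c \<noteq> 0" by auto
  with * show ?thesis using False
    by (subst char_sum[of "\<lambda>x. fr i x / fr j x" c]) (auto simp: fr_mult)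
qed

lemma fr_orthogonal': "(\<Sum>x\<in>UNIV-{0}. fr i x / x) = (if i mod 5 = 0 then -1 else 0)"
  using fr_orthogonal[of i 0] by simp

text \<open>
  Polarising the cubic identity turns it into a trilinear one, in which orthogonality isolates the
  term \<open>(d, e, f)\<close>. Unlike a comparison of exponents, this needs no care with carries for small \<open>q\<close>.
\<close>

lemma fr_triple_eq:
  assumes eq: "\<And>x. fr a x * fr b x * fr c x = fr d x * fr e x * fr f x"
    and dist: "d mod 5 \<noteq> e mod 5" "d mod 5 \<noteq> f mod 5" "e mod 5 \<noteq> f mod 5"
  shows "{a mod 5, b mod 5, c mod 5} = {d mod 5, e mod 5, f mod 5}"
proof -
  define P where "P i j k x y z =
    fr i x * fr j y * fr k z + fr i x * fr k y * fr j z + fr j x * fr i y * fr k z +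
    fr j x * fr k y * fr i z + fr k x * fr i y * fr j z + fr k x * fr j y * fr i z" for i j k x y z
  define Q where "Q i j k x = fr i x * fr j x * fr k x" for i j k x
  have polar: "P i j k x y z =
    Q i j k (x + y + z) - Q i j k (x + y) - Q i j k (x + z) - Q i j k (y + z)
    + Q i j k x + Q i j k y + Q i j k z" for i j k x y z
    by (simp add: P_def Q_def fr_add algebra_simps)
  have "Q a b c x = Q d e f x" for x by (simp add: Q_def eq)
  then have P_eq: "P a b c x y z = P d e f x y z" for x y z by (simp add: polar)
  define r where "r i j = (\<Sum>x\<in>UNIV-{0::'a}. fr i x / fr j x)" for i j
  have r: "r i j = (if i mod 5 = j mod 5 then -1 else 0)" for i j
    by (simp add: r_def fr_orthogonal)
  have summand: "(\<Sum>x\<in>UNIV-{0}. \<Sum>y\<in>UNIV-{0}. \<Sum>z\<in>UNIV-{0}.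
      fr i x * fr j y * fr k z / (fr d x * fr e y * fr f z)) = r i d * r j e * r k f" for i j k
  proof -
    have "r i d * r j e * r k f = r i d * (\<Sum>y\<in>UNIV-{0}. \<Sum>z\<in>UNIV-{0}.
        fr j y / fr e y * (fr k z / fr f z))"
      unfolding r_def sum_product[symmetric] by (rule mult.assoc)
    also have "\<dots> = (\<Sum>x\<in>UNIV-{0}. \<Sum>y\<in>UNIV-{0}. \<Sum>z\<in>UNIV-{0}.
        fr i x / fr d x * (fr j y / fr e y * (fr k z / fr f z)))"
      unfolding r_def sum_distrib_right by (simp only: sum_distrib_left)
    finally show ?thesis by (simp add: mult.assoc)
  qed
  have total: "(\<Sum>x\<in>UNIV-{0}. \<Sum>y\<in>UNIV-{0}. \<Sum>z\<in>UNIV-{0}.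
      P i j k x y z / (fr d x * fr e y * fr f z)) =
      r i d * r j e * r k f + r i d * r k e * r j f + r j d * r i e * r k f +
      r j d * r k e * r i f + r k d * r i e * r j f + r k d * r j e * r i f" for i j k
    unfolding P_def add_divide_distrib sum.distrib summand ..
  \<comment> \<open>The same total computed from (d, e, f): as these are distinct modulo 5, only the
    product of the three diagonal sums survives, and it is (-1)^3.\<close>
  have sum: "r a d * r b e * r c f + r a d * r c e * r b f + r b d * r a e * r c f +
      r b d * r c e * r a f + r c d * r a e * r b f + r c d * r b e * r a f = -1"
    unfolding total[symmetric] P_eq unfolding total using dist by (simp add: r)
  have zero: "r i d * r j e * r k f = 0"
    if "{a mod 5, b mod 5, c mod 5} \<noteq> {d mod 5, e mod 5, f mod 5}"
      "{i mod 5, j mod 5, k mod 5} = {a mod 5, b mod 5, c mod 5}" for i j k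
    using that by (cases "i mod 5 = d mod 5 \<and> j mod 5 = e mod 5 \<and> k mod 5 = f mod 5") (auto simp: r)
  show ?thesis
  proof (rule ccontr)
    assume ne: "{a mod 5, b mod 5, c mod 5} \<noteq> {d mod 5, e mod 5, f mod 5}"
    have "r a d * r b e * r c f = 0" "r a d * r c e * r b f = 0" "r b d * r a e * r c f = 0"
      "r b d * r c e * r a f = 0" "r c d * r a e * r b f = 0" "r c d * r b e * r a f = 0"
      by (rule zero[OF ne]; blast)+
    then show False using sum by (simp only: add_0_left) simp
  qed
qed

text \<open>The quotient is again a multiplicative character, and by \<open>fr_triple_eq\<close> it
  is trivial only if the two index sets agree.\<close>

lemma fr_triple_sum:
  assumes dist: "d mod 5 \<noteq> e mod 5" "d mod 5 \<noteq> f mod 5" "e mod 5 \<noteq> f mod 5"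
  shows "(\<Sum>x\<in>UNIV-{0}. fr a x * fr b x * fr c x / (fr d x * fr e x * fr f x)) =
    (if {a mod 5, b mod 5, c mod 5} = {d mod 5, e mod 5, f mod 5} then -1 else 0)"
    (is "sum ?\<psi> _ = _")
proof (cases "{a mod 5, b mod 5, c mod 5} = {d mod 5, e mod 5, f mod 5}")
  case True
  have "?\<psi> x = 1" if "x \<noteq> 0" for x
  proof -
    let ?f = "\<lambda>i. fr i x"
    have *: "prod ?f {i, j, k} = fr i x * fr j x * fr k x" if "i \<noteq> j" "i \<noteq> k" "j \<noteq> k" for i j k
      using that by simp
    have "card {a mod 5, b mod 5, c mod 5} = 3" unfolding True using dist by simp
    then have dist': "a mod 5 \<noteq> b mod 5" "a mod 5 \<noteq> c mod 5" "b mod 5 \<noteq> c mod 5"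
      by (auto simp: card_insert_if split: if_splits)
    have "fr a x * fr b x * fr c x = prod ?f {a mod 5, b mod 5, c mod 5}"
      unfolding *[OF dist'] by (simp flip: fr_mod)
    also have "\<dots> = fr d x * fr e x * fr f x"
      unfolding True *[OF dist] by (simp flip: fr_mod)
    finally show ?thesis using that by simp
  qed
  then have "sum ?\<psi> (UNIV-{0}) = (\<Sum>x\<in>UNIV-{0::'a}. 1)" by (intro sum.cong) auto
  then show ?thesis using True by (simp only: sum_1) auto
next
  case False
  then obtain c0 where "fr a c0 * fr b c0 * fr c c0 \<noteq> fr d c0 * fr e c0 * fr f c0"
    using fr_triple_eq[OF _ dist] by blast
  then have "c0 \<noteq> 0" "?\<psi> c0 \<noteq> 1" by auto
  moreover have "?\<psi> (x * y) = ?\<psi> x * ?\<psi> y" for x y by (simp add: fr_mult mult_ac)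
  ultimately have "sum ?\<psi> (UNIV-{0}) = 0" by (intro char_sum[of ?\<psi> c0])
  then show ?thesis using False by simp
qed

text \<open>
  If \<open>\<eta>\<close> were different from all powers of the Frobenius, then the sum of \<open>Tr z / \<eta> z = \<eta> (Tr z / z)\<close>
  over all \<open>z\<close> would be \<open>0\<close> by orthogonality, but it is \<open>\<eta> (- 1)\<close>.
\<close>

lemma automorphism_is_fr:
  assumes add: "\<And>x y. \<eta> (x + y) = \<eta> x + \<eta> y" and mult: "\<And>x y. \<eta> (x * y) = \<eta> x * \<eta> (y::'a)"
    and "\<eta> 1 \<noteq> 0" and fix_Fq: "\<And>x. x \<in> Fq q \<Longrightarrow> \<eta> x = x"
  obtains m where "m < 5" "\<eta> = fr m"
proof (rule ccontr)
  note choose = that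
  assume "\<not> thesis"
  then have no: "\<eta> \<noteq> fr i" if "i < 5" for i using choose[OF that] by blast
  have one: "\<eta> 1 = 1" using mult[of 1 1] assms(3) by simp
  have zero: "\<eta> 0 = 0" using add[of 0 0] by (metis add_0_right add_left_cancel)
  have eta_sum: "\<eta> (sum f X) = (\<Sum>x\<in>X. \<eta> (f x))" for f :: "'a \<Rightarrow> 'a" and X
    by (induction X rule: infinite_finite_induct) (auto simp: add zero)
  have eta_div: "\<eta> (x / y) * \<eta> y = \<eta> x" if "y \<noteq> 0" for x y
    using mult[of "x / y" y] that by simp
  have eta_nz: "\<eta> y \<noteq> 0" if "y \<noteq> 0" for y using eta_div[OF that, of 1] one by auto
  have orth: "(\<Sum>y\<in>UNIV-{0}. fr i y / \<eta> y) = 0" if "i < 5" for i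
  proof -
    obtain c where c: "\<eta> c \<noteq> fr i c" using no[OF \<open>i < 5\<close>] by (auto simp: fun_eq_iff)
    then have c0: "c \<noteq> 0" using zero by auto
    show ?thesis by (rule char_sum[of _ c]) (use c c0 eta_nz in \<open>auto simp: mult fr_mult\<close>)
  qed
  define Tr where "Tr z = (\<Sum>i<5. fr i z)" for z
  have Tr_Fq: "Tr z \<in> Fq q" for z
    unfolding Fq_iff Tr_def fr_sum fr_fr by (simp add: eval_nat_numeral)
  have "(\<Sum>z\<in>UNIV-{0}. Tr z / z) = (\<Sum>i<5. \<Sum>z\<in>UNIV-{0}. fr i z / z)"
    unfolding Tr_def sum_divide_distrib by (rule sum.swap)
  also have "\<dots> = (\<Sum>i::nat<5. if i = 0 then -1 else 0)"
    by (intro sum.cong refl) (simp add: fr_orthogonal')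
  also have "\<dots> = -1" by simp
  finally have Tr_sum: "(\<Sum>z\<in>UNIV-{0}. Tr z / z) = -1" .
  have "(\<Sum>z\<in>UNIV-{0}. Tr z / \<eta> z) = (\<Sum>i<5. \<Sum>z\<in>UNIV-{0}. fr i z / \<eta> z)"
    unfolding Tr_def sum_divide_distrib by (rule sum.swap)
  also have "\<dots> = 0" by (simp add: orth)
  also have "(\<Sum>z\<in>UNIV-{0}. Tr z / \<eta> z) = (\<Sum>z\<in>UNIV-{0}. \<eta> (Tr z / z))"
  proof (rule sum.cong)
    fix z :: 'a assume "z \<in> UNIV - {0}"
    then show "Tr z / \<eta> z = \<eta> (Tr z / z)"
      using eta_div[of z "Tr z"] fix_Fq[OF Tr_Fq[of z]] eta_nz[of z] by (simp add: field_simps)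
  qed auto
  also have "\<dots> = \<eta> (- 1)" by (simp add: Tr_sum flip: eta_sum)
  finally show False using eta_nz[of "-1"] by simp
qed

lemma norm5_fr_1: "norm5 q (x::'a) = x * fr 1 x * fr 2 x * fr 3 x * fr 4 x"
  by (simp add: norm5_def fr_def power_add)

text \<open>Multiplying the indices by \<open>m\<close> only permutes the five conjugates.\<close>

lemma norm5_fr:
  assumes "\<not> 5 dvd m"
  shows "norm5 q (x::'a) = x * fr m x * fr (2 * m) x * fr (3 * m) x * fr (4 * m) x"
proof -
  have "m mod 5 < 5" "m mod 5 \<noteq> 0" using assms by (auto simp: dvd_eq_mod_eq_0)
  then consider "m mod 5 = 1" | "m mod 5 = 2" | "m mod 5 = 3" | "m mod 5 = 4" by linarith
  then show ?thesis
  proof cases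
    case 1
    have "fr m = fr 1" "fr (2 * m) = fr 2" "fr (3 * m) = fr 3" "fr (4 * m) = fr 4"
      using fr_mod[of m] fr_mult_mod[of 2 m] fr_mult_mod[of 3 m] fr_mult_mod[of 4 m] 1 by simp_all
    then show ?thesis by (simp add: norm5_fr_1 mult_ac)
  next
    case 2
    have "fr m = fr 2" "fr (2 * m) = fr 4" "fr (3 * m) = fr 1" "fr (4 * m) = fr 3"
      using fr_mod[of m] fr_mult_mod[of 2 m] fr_mult_mod[of 3 m] fr_mult_mod[of 4 m] 2 by simp_all
    then show ?thesis by (simp add: norm5_fr_1 mult_ac)
  next
    case 3
    have "fr m = fr 3" "fr (2 * m) = fr 1" "fr (3 * m) = fr 4" "fr (4 * m) = fr 2"
      using fr_mod[of m] fr_mult_mod[of 2 m] fr_mult_mod[of 3 m] fr_mult_mod[of 4 m] 3 by simp_all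
    then show ?thesis by (simp add: norm5_fr_1 mult_ac)
  next
    case 4
    have "fr m = fr 4" "fr (2 * m) = fr 3" "fr (3 * m) = fr 2" "fr (4 * m) = fr 1"
      using fr_mod[of m] fr_mult_mod[of 2 m] fr_mult_mod[of 3 m] fr_mult_mod[of 4 m] 4 by simp_all
    then show ?thesis by (simp add: norm5_fr_1 mult_ac)
  qed
qed

lemma norm5_Fq: "norm5 q (x::'a) \<in> Fq q"
proof -
  have "1 + 1 = (2::nat)" "1 + 2 = (3::nat)" "1 + 3 = (4::nat)" "1 + 4 = (5::nat)" by simp_all
  then show ?thesis unfolding Fq_iff norm5_fr_1 fr_mult fr_fr by (simp only: fr_5 mult_ac)
qed

text \<open>The solution is a resolvent \<open>D u\<close>: applying \<open>fr t\<close> and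
  multiplying by \<open>\<delta>\<close> shifts its terms by one place, and the last term returns to
  \<open>u\<close> because the norm is 1.\<close>

lemma hilbert90:
  assumes "\<not> 5 dvd t" "norm5 q (\<delta>::'a) = 1"
  obtains D where "D \<noteq> 0" "D = \<delta> * fr t D"
proof -
  define D where "D u = u + \<delta> * fr t u + \<delta> * fr t \<delta> * fr (2 * t) u
    + \<delta> * fr t \<delta> * fr (2 * t) \<delta> * fr (3 * t) u
    + \<delta> * fr t \<delta> * fr (2 * t) \<delta> * fr (3 * t) \<delta> * fr (4 * t) u" for u
  have eq: "D u = \<delta> * fr t (D u)" for u
  proof -
    have "fr (5 * t) u = u" using fr_cong[of "5 * t" 0] by simp
    moreover have "\<delta> * fr t \<delta> * fr (2 * t) \<delta> * fr (3 * t) \<delta> * fr (4 * t) \<delta> = 1"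
      using norm5_fr[OF assms(1), of \<delta>] assms(2) by simp
    moreover have "\<delta> * fr t (D u) = \<delta> * fr t u + \<delta> * fr t \<delta> * fr (2 * t) u
      + \<delta> * fr t \<delta> * fr (2 * t) \<delta> * fr (3 * t) u
      + \<delta> * fr t \<delta> * fr (2 * t) \<delta> * fr (3 * t) \<delta> * fr (4 * t) u
      + \<delta> * fr t \<delta> * fr (2 * t) \<delta> * fr (3 * t) \<delta> * fr (4 * t) \<delta> * fr (5 * t) u"
      unfolding D_def fr_add fr_mult fr_fr by (simp add: algebra_simps flip: mult_2)
    ultimately show ?thesis by (simp add: D_def)
  qed
  have i: "\<not> 5 dvd t" "(2 * t) mod 5 \<noteq> 0" "(3 * t) mod 5 \<noteq> 0" "(4 * t) mod 5 \<noteq> 0" "t mod 5 \<noteq> 0"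
    using assms(1) not_dvd_mult_5[OF assms(1), of 2] not_dvd_mult_5[OF assms(1), of 3]
      not_dvd_mult_5[OF assms(1), of 4] by (auto simp: dvd_eq_mod_eq_0)
  have s: "(\<Sum>u\<in>UNIV-{0}. c * fr k u / u) = c * (if k mod 5 = 0 then -1 else 0)" for c k
    unfolding fr_orthogonal'[symmetric] by (simp add: sum_distrib_left)
  \<comment> \<open>Orthogonality kills every term but the first, so \<open>D\<close> is not
    identically zero.\<close>
  have "(\<Sum>u\<in>UNIV-{0}. D u / u) = -1"
    unfolding D_def add_divide_distrib sum.distrib s using s[of 1 0] i by simp
  then obtain u where "D u \<noteq> 0" by fastforce
  then show ?thesis using eq that by blast
qed

text \<open>
  With \<open>\<theta> = fr m\<close> one has \<open>(1 + \<theta>) (1 - \<theta> + \<theta>\<^sup>2 - \<theta>\<^sup>3 + \<theta>\<^sup>4) = 2\<close> in the group ring, since \<open>\<theta>\<^sup>5 = 1\<close>,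
  and \<open>a * norm5 q a\<close> is a square because the exponent of the norm is odd.
\<close>

lemma mult_fr_norm5:
  assumes "(a::'a) \<noteq> 0" obtains x where "x \<noteq> 0" "x * fr m x = a * norm5 q a"
proof -
  define n where "n = (norm_exp + 1) div 2"
  have "odd norm_exp" by (auto simp: norm_exp_def)
  then have n: "n + n = norm_exp + 1" unfolding n_def by presburger
  define b where "b = a ^ n"
  have b: "b \<noteq> 0" "b * b = a * norm5 q a"
    using assms n by (auto simp: b_def norm5_def norm_exp_def simp flip: power_add)
  define x where "x = b * fr (2 * m) b * fr (4 * m) b / (fr m b * fr (3 * m) b)"
  have "fr (5 * m) b = b" using fr_cong[of "5 * m" 0] by simp
  then have "fr m x = fr m b * fr (3 * m) b * b / (fr (2 * m) b * fr (4 * m) b)"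
    by (simp add: x_def fr_mult fr_divide fr_fr flip: mult_2)
  then have "x * fr m x = b * b" using b(1) by (simp add: x_def field_simps)
  then show ?thesis using that[of x] b by (auto simp: x_def)
qed

text \<open>The required equation for \<open>x\<close> and \<open>x * z\<close> says that
  \<open>D' = x * fr m (x * z) - x * z * fr m x\<close> satisfies
  \<open>D' = \<delta> * fr (4 * m) D'\<close>. Hilbert 90 provides nonzero solutions, and
  \<open>x\<close> is chosen to realise one of them.\<close>

lemma not_scattered_if_norm5_1:
  assumes m: "\<not> 5 dvd m" and "norm5 q (\<delta>::'a) = 1"
  obtains x z where "x \<noteq> 0" "z \<notin> Fq q"
    "(fr m (x * z) + \<delta> * fr (4 * m) (x * z)) * x = (fr m x + \<delta> * fr (4 * m) x) * (x * z)"
proof -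
  have "\<not> 5 dvd 4 * m" using not_dvd_mult_5[OF m, of 4] by simp
  then obtain D where D: "D \<noteq> 0" "D = \<delta> * fr (4 * m) D" using hilbert90 assms(2) by blast
  obtain z :: 'a where z: "fr m z \<noteq> z" using fr_nontrivial[OF m] .
  \<comment> \<open>\<open>D\<close> itself would need \<open>x * fr m x = a\<close>.
    \<open>mult_fr_norm5\<close> attains \<open>a\<close> only up to its norm, but this factor lies
    in F_q and so preserves the equation for \<open>D\<close>.\<close>
  define a where "a = D / (fr m z - z)"
  have a: "a \<noteq> 0" using z D(1) by (simp add: a_def)
  obtain x where x: "x \<noteq> 0" "x * fr m x = a * norm5 q a" using mult_fr_norm5[OF a] .
  define D' where "D' = D * norm5 q a"
  have D': "D' = \<delta> * fr (4 * m) D'"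
    using D(2) Fq_fr[OF norm5_Fq[of a]] by (simp add: D'_def fr_mult)
  have "x * fr m (x * z) - x * z * fr m x = (x * fr m x) * (fr m z - z)"
    by (simp add: fr_mult algebra_simps)
  also have "\<dots> = D'" unfolding x(2) using z by (simp add: a_def D'_def)
  finally have 1: "x * fr m (x * z) - x * z * fr m x = D'" .
  have "fr (4 * m + m) y = y" for y using fr_cong[of "4 * m + m" 0] by simp
  then have 2: "fr (4 * m) x * (x * z) - fr (4 * m) (x * z) * x = fr (4 * m) D'"
    unfolding 1[symmetric] by (simp add: fr_diff fr_mult fr_fr)
  show ?thesis
  proof (rule that[OF x(1)])
    show "z \<notin> Fq q" using z Fq_fr by blast
    have "(fr m (x * z) + \<delta> * fr (4 * m) (x * z)) * x - (fr m x + \<delta> * fr (4 * m) x) * (x * z) =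
      (x * fr m (x * z) - x * z * fr m x)
        - \<delta> * (fr (4 * m) x * (x * z) - fr (4 * m) (x * z) * x)"
      by (simp add: algebra_simps)
    also have "\<dots> = 0" unfolding 1 2 using D' by simp
    finally show "(fr m (x * z) + \<delta> * fr (4 * m) (x * z)) * x
      = (fr m x + \<delta> * fr (4 * m) x) * (x * z)" by simp
  qed
qed

section \<open>Linearized polynomials in powers of \<open>fr s\<close> and their moments\<close>

definition lin_poly :: "nat \<Rightarrow> (nat \<Rightarrow> 'a) \<Rightarrow> 'a \<Rightarrow> 'a" where
  "lin_poly s c x = (\<Sum>i<5. c i * fr (s * i) x)"

text \<open>After expansion, \<open>fr_triple_sum\<close> keeps exactly the index triples with {i, j
  + 1, k + 2} = {0, 1, 2} modulo 5, which are the six terms. Three separate coefficient families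
  allow the identity polynomial to be inserted in place of a factor.\<close>

lemma lin_poly_triple_sum:
  assumes s: "\<not> 5 dvd s"
  shows "(\<Sum>x\<in>UNIV-{0}. lin_poly s a x / x * fr s (lin_poly s b x / x) * fr (2 * s) (lin_poly s c x / x)) =
    - (a 0 * fr s (b 0) * fr (2 * s) (c 0) + a 0 * fr s (b 1) * fr (2 * s) (c 4)
     + a 1 * fr s (b 4) * fr (2 * s) (c 0) + a 1 * fr s (b 1) * fr (2 * s) (c 3)
     + a 2 * fr s (b 4) * fr (2 * s) (c 4) + a 2 * fr s (b 0) * fr (2 * s) (c 3))"
proof -
  \<comment> \<open>Injectivity of this map on residues removes \<open>s\<close> from the index
    condition.\<close>
  define f where "f t = s * t mod 5" for t
  have inj_f: "inj_on f {..<5}"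
  proof (rule inj_onI)
    fix x y assume xy: "x \<in> {..<5}" "y \<in> {..<5}" "f x = f y"
    obtain k where k: "k * s mod 5 = 1" using exists_inverse_mod_5[OF s] .
    have *: "z = k * f z mod 5" if "z < 5" for z
    proof -
      have "k * f z mod 5 = k * (s * z) mod 5" by (simp add: f_def mod_mult_right_eq)
      also have "\<dots> = (k * s mod 5) * z mod 5" by (simp only: mod_mult_left_eq mult.assoc)
      finally show ?thesis using k that by simp
    qed
    show "x = y" using *[of x] *[of y] xy by simp
  qed
  have f_mod: "s * t mod 5 = f (t mod 5)" for t by (simp add: f_def mod_mult_right_eq)
  have key: "(\<Sum>x\<in>UNIV-{0}. fr (s * i) x / x * (fr (s * j + s) x / fr s x) * (fr (s * k + 2 * s) x / fr (2 * s) x)) =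
    (if i mod 5 < 3 \<and> (j + 1) mod 5 < 3 \<and> (k + 2) mod 5 < 3 \<and> i mod 5 \<noteq> (j + 1) mod 5
      \<and> i mod 5 \<noteq> (k + 2) mod 5 \<and> (j + 1) mod 5 \<noteq> (k + 2) mod 5 then -1 else 0)" for i j k
  proof -
    have ne: "f 0 \<noteq> f 1" "f 0 \<noteq> f 2" "f 1 \<noteq> f 2"
      using inj_on_eq_iff[OF inj_f, of 0 1] inj_on_eq_iff[OF inj_f, of 0 2]
        inj_on_eq_iff[OF inj_f, of 1 2] by simp_all
    have st: "s * 0 mod 5 = f 0" "s * 1 mod 5 = f 1" "s * 2 mod 5 = f 2" by (simp_all add: f_def)
    have dist: "s * 0 mod 5 \<noteq> s * 1 mod 5" "s * 0 mod 5 \<noteq> s * 2 mod 5" "s * 1 mod 5 \<noteq> s * 2 mod 5"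
      using ne unfolding st by auto
    have "{s * i mod 5, s * (j + 1) mod 5, s * (k + 2) mod 5} = {s * 0 mod 5, s * 1 mod 5, s * 2 mod 5}
      \<longleftrightarrow> f ` {i mod 5, (j + 1) mod 5, (k + 2) mod 5} = f ` {0, 1, 2}"
      unfolding f_mod by simp
    also have "\<dots> \<longleftrightarrow> {i mod 5, (j + 1) mod 5, (k + 2) mod 5} = {0, 1, 2}"
      by (rule inj_on_image_eq_iff[OF inj_f]) auto
    finally have iff: "{s * i mod 5, s * (j + 1) mod 5, s * (k + 2) mod 5} =
      {s * 0 mod 5, s * 1 mod 5, s * 2 mod 5} \<longleftrightarrow> {i mod 5, (j + 1) mod 5, (k + 2) mod 5} = {0, 1, 2}" .
    have "(\<Sum>x\<in>UNIV-{0}. fr (s * i) x / x * (fr (s * j + s) x / fr s x) * (fr (s * k + 2 * s) x / fr (2 * s) x))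
      = (\<Sum>x\<in>UNIV-{0}. fr (s * i) x * fr (s * (j + 1)) x * fr (s * (k + 2)) x
          / (fr (s * 0) x * fr (s * 1) x * fr (s * 2) x))"
    proof -
      have mult: "s * (j + 1) = s * j + s" "s * (k + 2) = s * k + 2 * s" "s * 2 = 2 * s" by simp_all
      show ?thesis unfolding mult by simp
    qed
    then show ?thesis unfolding fr_triple_sum[OF dist] iff set3_eq .
  qed
  have quot: "lin_poly s a x / x * fr s (lin_poly s b x / x) * fr (2 * s) (lin_poly s c x / x) =
    (\<Sum>i<5. \<Sum>j<5. \<Sum>k<5. a i * fr s (b j) * fr (2 * s) (c k) *
      (fr (s * i) x / x * (fr (s * j + s) x / fr s x) * (fr (s * k + 2 * s) x / fr (2 * s) x)))" for x
  proof -
    have 1: "lin_poly s a x / x = (\<Sum>i<5. a i * (fr (s * i) x / x))"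
      by (simp add: lin_poly_def sum_divide_distrib)
    have 2: "fr s (lin_poly s b x / x) = (\<Sum>j<5. fr s (b j) * (fr (s * j + s) x / fr s x))"
      by (simp add: lin_poly_def sum_divide_distrib fr_sum fr_divide fr_mult fr_fr add.commute)
    have 3: "fr (2 * s) (lin_poly s c x / x) = (\<Sum>k<5. fr (2 * s) (c k) * (fr (s * k + 2 * s) x / fr (2 * s) x))"
      by (simp add: lin_poly_def sum_divide_distrib fr_sum fr_divide fr_mult fr_fr add.commute)
    have "lin_poly s a x / x * fr s (lin_poly s b x / x) * fr (2 * s) (lin_poly s c x / x) =
      (\<Sum>i<5. a i * (fr (s * i) x / x) * (\<Sum>j<5. \<Sum>k<5. fr s (b j) * (fr (s * j + s) x / fr s x)
        * (fr (2 * s) (c k) * (fr (s * k + 2 * s) x / fr (2 * s) x))))"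
      unfolding 1 2 3 mult.assoc sum_product[symmetric] sum_distrib_right
      by (simp only: sum_distrib_left mult.assoc)
    then show ?thesis by (simp add: sum_distrib_left mult_ac)
  qed
  have "(\<Sum>x\<in>UNIV-{0}. lin_poly s a x / x * fr s (lin_poly s b x / x) * fr (2 * s) (lin_poly s c x / x)) =
    (\<Sum>i<5. \<Sum>j<5. \<Sum>k<5. a i * fr s (b j) * fr (2 * s) (c k) * (\<Sum>x\<in>UNIV-{0}.
      (fr (s * i) x / x * (fr (s * j + s) x / fr s x) * (fr (s * k + 2 * s) x / fr (2 * s) x))))"
    unfolding quot sum_distrib_left
    by (subst sum.swap, intro sum.cong refl, subst sum.swap, intro sum.cong refl, rule sum.swap)
  then show ?thesis unfolding key sum_lessThan_5 by simp
qed

text \<open>Each moment simplifies the next: first \<open>c 0\<close> vanishes, then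
  \<open>c 1\<close> and \<open>c 4\<close> are seen to be nonzero, then one of \<open>c 2\<close>
  and \<open>c 3\<close> vanishes, and the triple moment settles the other.\<close>

lemma LP_coefficients:
  assumes s: "\<not> 5 dvd s" and \<delta>: "\<delta> \<noteq> 0"
    and eq: "\<And>h. (\<Sum>x\<in>UNIV-{0}. h (lin_poly s c x / x)) =
      (\<Sum>x\<in>UNIV-{0}. (h ((fr s x + \<delta> * fr (4 * s) x) / x)) :: 'a)"
  shows "c 0 = 0" "c 2 = 0" "c 3 = 0" "c 1 \<noteq> 0" "c 4 \<noteq> 0"
proof -
  define d where "d i = (if i = 1 then 1 else if i = 4 then \<delta> else 0)" for i :: nat
  \<comment> \<open>The identity polynomial: its quotient by \<open>x\<close> is 1, so inserting it
    in the triple sum gives the moments with one or two factors.\<close>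
  define e where "e i = (if i = 0 then 1 else 0::'a)" for i :: nat
  have d: "lin_poly s d x = fr s x + \<delta> * fr (4 * s) x" for x
    by (simp add: lin_poly_def sum_lessThan_5 d_def mult.commute)
  have e: "lin_poly s e x = x" for x
    by (simp add: lin_poly_def sum_lessThan_5 e_def)
  note eq' = eq[folded d]
  note ts = lin_poly_triple_sum[OF s]
  have "(\<Sum>x\<in>UNIV-{0}. lin_poly s a x / x * fr s (lin_poly s e x / x) * fr (2 * s) (lin_poly s e x / x))
    = (\<Sum>x\<in>UNIV-{0}. lin_poly s a x / x)" for a
    by (intro sum.cong) (auto simp: e)
  then have "(\<Sum>x\<in>UNIV-{0}. lin_poly s a x / x) = - a 0" for a
    using ts[of a e e] by (simp add: e_def)
  then show c0: "c 0 = 0" using eq'[of "\<lambda>w. w"] by (simp add: d_def)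
  have "(\<Sum>x\<in>UNIV-{0}. lin_poly s a x / x * fr s (lin_poly s a x / x) * fr (2 * s) (lin_poly s e x / x))
    = (\<Sum>x\<in>UNIV-{0}. lin_poly s a x / x * fr s (lin_poly s a x / x))" for a
    by (intro sum.cong) (auto simp: e)
  then have "(\<Sum>x\<in>UNIV-{0}. lin_poly s a x / x * fr s (lin_poly s a x / x))
    = - (a 0 * fr s (a 0) + a 1 * fr s (a 4))" for a
    using ts[of a a e] by (simp add: e_def)
  then have "c 1 * fr s (c 4) = fr s \<delta>" using eq'[of "\<lambda>w. w * fr s w"] c0 by (simp add: d_def)
  then show c1: "c 1 \<noteq> 0" and c4: "c 4 \<noteq> 0" using \<delta> by auto
  have "(\<Sum>x\<in>UNIV-{0}. lin_poly s a x / x * fr s (lin_poly s e x / x) * fr (2 * s) (lin_poly s a x / x))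
    = (\<Sum>x\<in>UNIV-{0}. lin_poly s a x / x * fr (2 * s) (lin_poly s a x / x))" for a
    by (intro sum.cong) (auto simp: e)
  then have "(\<Sum>x\<in>UNIV-{0}. lin_poly s a x / x * fr (2 * s) (lin_poly s a x / x))
    = - (a 0 * fr (2 * s) (a 0) + a 2 * fr (2 * s) (a 3))" for a
    using ts[of a e a] by (simp add: e_def)
  then have c23: "c 2 = 0 \<or> c 3 = 0" using eq'[of "\<lambda>w. w * fr (2 * s) w"] c0 by (simp add: d_def)
  \<comment> \<open>Once one of \<open>c 2\<close>, \<open>c 3\<close> is zero, a single product
    remains, whose other factors are nonzero.\<close>
  have "c 1 * fr s (c 1) * fr (2 * s) (c 3) + c 2 * fr s (c 4) * fr (2 * s) (c 4) = 0"
    using eq'[of "\<lambda>w. w * fr s w * fr (2 * s) w"] c0 unfolding ts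
    by (simp add: d_def neg_eq_iff_add_eq_0)
  then show "c 2 = 0" "c 3 = 0" using c23 c1 c4 by auto
qed

end

subsection \<open>Projections of the fixed vectors\<close>

lemma line_proportional:
  fixes u v :: "'a::field ^ 2"
  assumes "k1 * u $ 1 + k2 * u $ 2 = 0" "k1 * v $ 1 + k2 * v $ 2 = 0" "v $ 1 \<noteq> 0 \<or> v $ 2 \<noteq> 0"
    and "k1 \<noteq> 0 \<or> k2 \<noteq> 0"
  shows "\<exists>c. u = c *s v"
proof (cases "k1 = 0")
  case True
  then have "u $ 2 = 0" "v $ 2 = 0" "v $ 1 \<noteq> 0" using assms by auto
  then show ?thesis by (intro exI[of _ "u $ 1 / v $ 1"]) (simp add: vec_eq_iff forall_2)
next
  case False
  then have "u $ 1 = - (k2 / k1) * u $ 2" "v $ 1 = - (k2 / k1) * v $ 2"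
    using assms(1,2) by (simp_all add: field_simps eq_neg_iff_add_eq_0)
  moreover from this have "v $ 2 \<noteq> 0" using assms(3) by auto
  ultimately show ?thesis by (intro exI[of _ "u $ 2 / v $ 2"]) (simp add: vec_eq_iff forall_2)
qed

text \<open>Dependent columns of a 2 by 2 matrix force dependent rows. The form (k1, k2) is the kind
  of input that \<open>orbit_not_collinear\<close> takes.\<close>

lemma singular_kernel:
  fixes u v :: "'a::field ^ 2"
  assumes "c * u $ 1 + d * v $ 1 = 0" "c * u $ 2 + d * v $ 2 = 0" "c \<noteq> 0 \<or> d \<noteq> 0"
  obtains k1 k2 where "k1 \<noteq> 0 \<or> k2 \<noteq> 0" "k1 * u $ 1 + k2 * u $ 2 = 0" "k1 * v $ 1 + k2 * v $ 2 = 0"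
proof -
  have det: "u $ 1 * v $ 2 = u $ 2 * v $ 1"
  proof -
    have "c * (u $ 1 * v $ 2 - u $ 2 * v $ 1) = 0" "d * (u $ 1 * v $ 2 - u $ 2 * v $ 1) = 0"
      using assms(1,2) by algebra+
    then show ?thesis using assms(3) by auto
  qed
  show ?thesis
  proof (cases "u = 0")
    case True
    show ?thesis
    proof (cases "v = 0")
      case True
      then show ?thesis using \<open>u = 0\<close> by (intro that[of 1 0]) auto
    next
      case False
      then show ?thesis using \<open>u = 0\<close>
        by (intro that[of "- v $ 2" "v $ 1"]) (auto simp: vec_eq_iff forall_2)
    qed
  next
    case False
    then show ?thesis using det
      by (intro that[of "- u $ 2" "u $ 1"]) (auto simp: vec_eq_iff forall_2)
  qed
qed

text \<open>\<open>T k\<close> is the k-th power of a semilinear map whose fixed vectors are the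
  F_q-form under \<Sigma>; having all powers at hand lets one locale serve both \<sigma> and its
  square. The last assumption is scatteredness for vectors: fixed vectors with the same image point
  are F_q-proportional.\<close>

locale scattered_projection = quintic_field q K
  for q and K :: "'a::{field,finite} itself" +
  fixes T :: "nat \<Rightarrow> 'a ^ 5 \<Rightarrow> 'a ^ 5" and N :: "'a ^ 5 \<Rightarrow> 'a ^ 2"
  assumes T_add: "T k (u + v) = T k u + T k v"
    and T_scale: "T k (c *s v) = fr k c *s T k v"
    and T_T: "T k (T l v) = T (k + l) v"
    and T_0 [simp]: "T 0 v = v" and T_5 [simp]: "T 5 v = v"
    and card_fixed: "card {v. T 1 v = v} = q ^ 5"
    and N_add: "N (u + v) = N u + N v" and N_scale: "N (c *s v) = c *s N v"
    and N_nonzero: "T 1 v = v \<Longrightarrow> v \<noteq> 0 \<Longrightarrow> N v \<noteq> 0"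
    and scattered: "T 1 v = v \<Longrightarrow> T 1 w = w \<Longrightarrow> v \<noteq> 0 \<Longrightarrow> w \<noteq> 0 \<Longrightarrow> N v = c *s N w \<Longrightarrow>
      \<exists>d\<in>Fq q. v = d *s w"
begin

definition fixed :: "('a ^ 5) set" where
  "fixed = {v. T 1 v = v}"

lemma T_zero [simp]: "T k 0 = 0"
  using T_scale[of k 0 0] by simp

lemma N_zero [simp]: "N 0 = 0"
  using N_scale[of 0 0] by simp

lemma T_sum: "T k (sum f X) = (\<Sum>x\<in>X. T k (f x))"
  by (induction X rule: infinite_finite_induct) (auto simp: T_add)

lemma N_sum: "N (sum f X) = (\<Sum>x\<in>X. N (f x))"
  by (induction X rule: infinite_finite_induct) (auto simp: N_add)

lemma T_add_mult_5: "T (k + 5 * n) v = T k v"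
proof (induction n)
  case (Suc n)
  have "T (k + 5 * Suc n) v = T (k + 5 * n) (T 5 v)"
    unfolding T_T by (simp add: algebra_simps)
  then show ?case using Suc by simp
qed auto

lemma T_mod: "T k = T (k mod 5)"
  using T_add_mult_5[of "k mod 5" "k div 5"] by (auto simp: fun_eq_iff)

lemma T_cong: "k mod 5 = l mod 5 \<Longrightarrow> T k = T l"
  using T_mod[of k] T_mod[of l] by simp

lemma T_mult_5 [simp]: "T (5 * k) v = v"
  using T_cong[of "5 * k" 0] by simp

lemma T_eq_0 [simp]: "T k v = 0 \<longleftrightarrow> v = 0"
proof
  assume "T k v = 0"
  have "T (4 * k + k) v = T (4 * k) (T k v)" by (simp only: T_T)
  also have "\<dots> = 0" using \<open>T k v = 0\<close> by simp
  finally have "T (4 * k + k) v = 0" .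
  then show "v = 0" using T_cong[of "4 * k + k" 0] by simp
qed simp

lemma fixed_T: "v \<in> fixed \<Longrightarrow> T k v = v"
proof (induction k)
  case (Suc k)
  have "T (Suc k) v = T k (T 1 v)" by (simp add: T_T)
  then show ?case using Suc by (simp add: fixed_def)
qed simp

lemma fixed_N_nonzero: "v \<in> fixed \<Longrightarrow> v \<noteq> 0 \<Longrightarrow> N v \<noteq> 0"
  using N_nonzero by (simp add: fixed_def)

lemma fixed_diff: "v \<in> fixed \<Longrightarrow> w \<in> fixed \<Longrightarrow> v - w \<in> fixed"
proof -
  have "T 1 (v - w) + T 1 w = T 1 v" by (simp flip: T_add)
  then show "v \<in> fixed \<Longrightarrow> w \<in> fixed \<Longrightarrow> v - w \<in> fixed"
    by (simp add: fixed_def eq_diff_eq)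
qed

text \<open>The trace of \<open>x *s a\<close> over the cyclic group generated by
  \<open>T 1\<close>.\<close>

definition tr :: "'a ^ 5 \<Rightarrow> 'a \<Rightarrow> 'a ^ 5" where
  "tr a x = (\<Sum>i<5. fr i x *s T i a)"

lemma tr_fixed: "tr a x \<in> fixed"
proof -
  let ?f = "\<lambda>i. T i (x *s a)"
  have "T 1 (tr a x) = (\<Sum>i<5. ?f (Suc i))"
    by (simp add: tr_def T_sum T_T flip: T_scale)
  \<comment> \<open>The shift trades term 0 for term 5, and these agree because \<open>T 5\<close>
    is the identity.\<close>
  also have "\<dots> = (\<Sum>i<5. ?f i) + ?f 5 - ?f 0"
    using sum.lessThan_Suc_shift[of ?f 5] sum.lessThan_Suc[of ?f 5] by (simp add: algebra_simps)
  finally show ?thesis by (simp add: fixed_def tr_def flip: T_scale)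
qed

lemma tr_expand:
  assumes "\<not> 5 dvd m"
  shows "tr a x = x *s a + fr m x *s T m a + fr (2 * m) x *s T (2 * m) a
    + fr (3 * m) x *s T (3 * m) a + fr (4 * m) x *s T (4 * m) a"
  unfolding tr_def
  by (subst sum_periodic_5[OF assms]) (use fr_mod T_mod in \<open>auto intro: arg_cong2\<close>)

lemma tr_diff: "tr a (x - y) = tr a x - tr a y"
  by (simp add: tr_def fr_diff vector_sub_rdistrib sum_subtractf)

text \<open>Orthogonality isolates the term i = 0, so every vector is a combination of fixed
  vectors.\<close>

lemma tr_recover: "(\<Sum>x\<in>UNIV-{0}. (1 / x) *s tr a x) = - a"
proof -
  have "(\<Sum>x\<in>UNIV-{0}. (1 / x) *s tr a x) = (\<Sum>x\<in>UNIV-{0}. \<Sum>i<5. (fr i x / x) *s T i a)"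
    by (simp add: tr_def vec.scale_sum_right)
  also have "\<dots> = (\<Sum>i<5. (\<Sum>x\<in>UNIV-{0}. fr i x / x) *s T i a)"
    unfolding vec.scale_sum_left by (rule sum.swap)
  also have "\<dots> = - a" unfolding fr_orthogonal' sum_lessThan_5 by simp
  finally show ?thesis .
qed

text \<open>
  If the orbit of \<open>a\<close> projected into one point, then all the fixed vectors \<open>tr a x\<close> would be multiples
  of one fixed vector, and so would \<open>a\<close>, which is a combination of them. This vector would then
  lie in the kernel of \<open>N\<close>.
\<close>

lemma orbit_not_collinear:
  assumes "a \<noteq> 0" "N a = 0" and k: "k1 \<noteq> 0 \<or> k2 \<noteq> 0"
    and line: "\<And>i. k1 * N (T i a) $ 1 + k2 * N (T i a) $ 2 = 0"
  shows False
proof -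
  have "\<exists>x. tr a x \<noteq> 0"
  proof (rule ccontr)
    assume "\<not> ?thesis"
    then show False using tr_recover[of a] assms(1) by simp
  qed
  then obtain x0 where x0: "tr a x0 \<noteq> 0" by blast
  define w where "w = tr a x0"
  have w: "w \<in> fixed" "w \<noteq> 0" "N w \<noteq> 0" using x0 tr_fixed fixed_N_nonzero by (auto simp: w_def)
  have lin: "k1 * N (tr a x) $ 1 + k2 * N (tr a x) $ 2 = 0" for x
  proof -
    have "k1 * N (tr a x) $ 1 + k2 * N (tr a x) $ 2 =
      (\<Sum>i<5. fr i x * (k1 * N (T i a) $ 1 + k2 * N (T i a) $ 2))"
      by (simp add: tr_def N_sum N_scale sum_distrib_left sum.distrib algebra_simps)
    then show ?thesis by (simp add: line)
  qed
  have multiple_w: "\<exists>d. tr a x = d *s w" for x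
  proof (cases "tr a x = 0")
    case True
    then show ?thesis by (intro exI[of _ 0]) simp
  next
    case False
    have "\<exists>c. N (tr a x) = c *s N w"
    proof -
      let ?u = "N (tr a x)" and ?v = "N w"
      have "k1 * ?u $ 1 + k2 * ?u $ 2 = 0" "k1 * ?v $ 1 + k2 * ?v $ 2 = 0"
        using lin[of x] lin[of x0] by (auto simp: w_def)
      moreover have "?v $ 1 \<noteq> 0 \<or> ?v $ 2 \<noteq> 0" using w(3) by (auto simp: vec_eq_iff forall_2)
      ultimately show ?thesis using k by (rule line_proportional)
    qed
    then show ?thesis
      using scattered[of "tr a x" w] tr_fixed[of a x] w False by (auto simp: fixed_def)
  qed
  then obtain d where d: "\<And>x. tr a x = d x *s w" by metis
  have "- a = (\<Sum>x\<in>UNIV-{0}. (1 / x) * d x) *s w"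
    unfolding tr_recover[symmetric] d by (simp add: vec.scale_sum_left)
  then have a: "a = (- (\<Sum>x\<in>UNIV-{0}. (1 / x) * d x)) *s w"
    by (metis minus_equation_iff vec.scale_minus_left)
  then have "N a = (- (\<Sum>x\<in>UNIV-{0}. (1 / x) * d x)) *s N w" using N_scale by metis
  then have "(\<Sum>x\<in>UNIV-{0}. (1 / x) * d x) = 0" using w(3) assms(2) by simp
  then show False using a assms(1) by simp
qed

text \<open>
  In terms of the collineation \<open>\<sigma>\<close> induced by \<open>T m\<close>, the kernel \<open>\<Gamma>\<close> of \<open>N\<close> contains two consecutive
  points \<open>P\<close> and \<open>P\<^sup>\<sigma>\<close> of an orbit and a third point of the line joining the images of \<open>P\<close> under
  \<open>\<sigma>\<^sup>2\<close> and \<open>\<sigma>\<^sup>4\<close>.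
\<close>

definition LP_plane :: "nat \<Rightarrow> bool" where
  "LP_plane m \<longleftrightarrow> (\<exists>a \<alpha> \<beta>. \<alpha> \<noteq> 0 \<and> \<beta> \<noteq> 0 \<and> N a = 0 \<and> N (T m a) = 0 \<and>
     \<alpha> *s N (T (2 * m) a) + \<beta> *s N (T (4 * m) a) = 0 \<and>
     (\<forall>c d. c *s N (T (2 * m) a) + d *s N (T (3 * m) a) = 0 \<longrightarrow> c = 0 \<and> d = 0))"

lemma LP_plane_cong:
  assumes "m mod 5 = n mod 5" shows "LP_plane m \<longleftrightarrow> LP_plane n"
proof -
  have "T (c * m) = T (c * n)" for c
    by (rule T_cong) (metis assms mod_mult_right_eq)
  from this[of 1] this[of 2] this[of 3] this[of 4] show ?thesis by (simp add: LP_plane_def)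
qed

text \<open>Reading the orbit backwards from \<open>T m a\<close> sends index i to 1 - i modulo 5.
  This swaps 0 with 1 and 2 with 4 and fixes 3, so only \<open>\<alpha>\<close> and
  \<open>\<beta>\<close> change places.\<close>

lemma LP_plane_inverse:
  assumes "LP_plane m" shows "LP_plane (4 * m)"
proof -
  obtain a \<alpha> \<beta> where *: "\<alpha> \<noteq> 0" "\<beta> \<noteq> 0" "N a = 0" "N (T m a) = 0"
    "\<alpha> *s N (T (2 * m) a) + \<beta> *s N (T (4 * m) a) = 0"
    "\<And>c d. c *s N (T (2 * m) a) + d *s N (T (3 * m) a) = 0 \<Longrightarrow> c = 0 \<and> d = 0"
    using assms unfolding LP_plane_def by blast
  have red: "T (k * m) = T (l * m)" if "k mod 5 = l mod 5" for k l
    by (rule T_cong) (metis that mod_mult_left_eq)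
  have T: "T (4 * m) (T m a) = a" "T (2 * (4 * m)) (T m a) = T (4 * m) a"
    "T (3 * (4 * m)) (T m a) = T (3 * m) a" "T (4 * (4 * m)) (T m a) = T (2 * m) a"
    using red[of 5 0] red[of 9 4] red[of 13 3] red[of 17 2] by (simp_all add: T_T algebra_simps)
  have u4: "N (T (4 * m) a) = (- \<alpha> / \<beta>) *s N (T (2 * m) a)"
  proof -
    have "\<beta> *s N (T (4 * m) a) = (- \<alpha>) *s N (T (2 * m) a)" using *(5) by (simp add: eq_neg_iff_add_eq_0 add.commute)
    then have "(1 / \<beta>) *s (\<beta> *s N (T (4 * m) a)) = (1 / \<beta>) *s ((- \<alpha>) *s N (T (2 * m) a))" by simp
    then show ?thesis using *(2) by simp
  qed
  show ?thesis unfolding LP_plane_def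
  proof (intro exI conjI allI impI)
    show "\<beta> \<noteq> 0" "\<alpha> \<noteq> 0" by fact+
    show "N (T m a) = 0" "N (T (4 * m) (T m a)) = 0" using * T by simp_all
    show "\<beta> *s N (T (2 * (4 * m)) (T m a)) + \<alpha> *s N (T (4 * (4 * m)) (T m a)) = 0"
      unfolding T using *(5) by (simp add: add.commute)
    fix c d
    assume "c *s N (T (2 * (4 * m)) (T m a)) + d *s N (T (3 * (4 * m)) (T m a)) = 0"
    then have "(c * (- \<alpha> / \<beta>)) *s N (T (2 * m) a) + d *s N (T (3 * m) a) = 0"
      unfolding T u4 by simp
    from *(6)[OF this] show "c = 0" "d = 0" using *(1,2) by auto
  qed
qed

text \<open>Otherwise the whole orbit of \<open>a\<close> would consist of multiples of
  \<open>a\<close> and lie in the kernel of \<open>N\<close>.\<close>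

lemma orbit_not_scalar:
  assumes "\<not> 5 dvd t" "a \<noteq> 0" "N a = 0" shows "T t a \<noteq> c *s a"
proof
  assume c: "T t a = c *s a"
  have multiple: "\<exists>c. T (k * t) a = c *s a" for k
  proof (induction k)
    case 0
    then show ?case by (intro exI[of _ 1]) simp
  next
    case (Suc k)
    then obtain c' where "T (k * t) a = c' *s a" by blast
    then have "T t (T (k * t) a) = (fr t c' * c) *s a" by (simp add: T_scale c)
    then show ?case by (auto simp: T_T)
  qed
  have "N (T i a) = 0" for i
  proof -
    obtain k where k: "k * t mod 5 = 1" using exists_inverse_mod_5[OF assms(1)] .
    have "(i * k) * t mod 5 = i * (k * t mod 5) mod 5" by (simp only: mod_mult_right_eq mult.assoc)
    then have "T i = T ((i * k) * t)" using k by (intro T_cong) simp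
    then show ?thesis using multiple[of "i * k"] assms(3) by (auto simp: N_scale)
  qed
  then show False using orbit_not_collinear[of a 1 0] assms by simp
qed

text \<open>If \<open>\<alpha>\<close> or \<open>\<beta>\<close> were 0, then
  \<open>T (4 * m) a\<close> or \<open>T m a\<close> would have the property that characterises
  \<open>a\<close> up to scalars, against \<open>orbit_not_scalar\<close>. Independence of the
  images at 2 and 3 comes from \<open>orbit_not_collinear\<close>.\<close>

lemma LP_planeI:
  assumes m: "\<not> 5 dvd m" and a: "a \<noteq> 0" "N a = 0" "N (T m a) = 0"
    and unique: "\<And>w. w \<noteq> 0 \<Longrightarrow> N w = 0 \<Longrightarrow> N (T m w) = 0 \<Longrightarrow> \<exists>c. w = c *s a"
    and e: "\<alpha> *s T (2 * m) a + \<beta> *s T (4 * m) a \<noteq> 0"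
      "N (\<alpha> *s T (2 * m) a + \<beta> *s T (4 * m) a) = 0"
  shows "LP_plane m"
proof -
  define u where "u i = N (T (i * m) a)" for i
  have u: "u 0 = 0" "u 1 = 0" "\<alpha> *s u 2 + \<beta> *s u 4 = 0"
    using a e by (auto simp: u_def N_add N_scale)
  have m4: "\<not> 5 dvd 4 * m" using not_dvd_mult_5[OF m, of 4] by simp
  have \<beta>: "\<beta> \<noteq> 0"
  proof
    assume "\<beta> = 0"
    then have "\<alpha> \<noteq> 0" "\<alpha> *s u 2 = 0" using e(1) u(3) by auto
    then have "N (T m (T m a)) = 0" by (simp add: u_def T_T mult_2)
    then show False using unique[of "T m a"] orbit_not_scalar[OF m a(1,2)] a by auto
  qed
  have \<alpha>: "\<alpha> \<noteq> 0"
  proof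
    assume "\<alpha> = 0"
    then have "N (T (4 * m) a) = 0" using \<beta> u(3) by (simp add: u_def)
    moreover have "T m (T (4 * m) a) = a" using T_mult_5[of m a] by (simp add: T_T)
    ultimately show False using unique[of "T (4 * m) a"] orbit_not_scalar[OF m4 a(1,2)] a by auto
  qed
  have u4: "u 4 = (- \<alpha> / \<beta>) *s u 2"
  proof -
    have "\<beta> *s u 4 = (- \<alpha>) *s u 2" using u(3) by (simp add: eq_neg_iff_add_eq_0 add.commute)
    then have "(1 / \<beta>) *s (\<beta> *s u 4) = (1 / \<beta>) *s ((- \<alpha>) *s u 2)" by simp
    then show ?thesis using \<beta> by simp
  qed
  \<comment> \<open>The images along the orbit are 0, 0, \<open>u 2\<close>, \<open>u 3\<close> and
    a multiple of \<open>u 2\<close>, so a form vanishing on \<open>u 2\<close> and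
    \<open>u 3\<close> vanishes on all five.\<close>
  have no_line: False if "k1 \<noteq> 0 \<or> k2 \<noteq> 0" "k1 * u 2 $ 1 + k2 * u 2 $ 2 = 0"
    "k1 * u 3 $ 1 + k2 * u 3 $ 2 = 0" for k1 k2
  proof (rule orbit_not_collinear[OF a(1,2) that(1)])
    fix i
    have 4: "k1 * u 4 $ 1 + k2 * u 4 $ 2 = 0"
    proof -
      have "k1 * u 4 $ 1 + k2 * u 4 $ 2 = (- \<alpha> / \<beta>) * (k1 * u 2 $ 1 + k2 * u 2 $ 2)"
        unfolding u4 by (simp add: algebra_simps)
      then show ?thesis using that(2) by simp
    qed
    obtain k where k: "k * m mod 5 = 1" using exists_inverse_mod_5[OF m] .
    have "(i * k mod 5) * m mod 5 = i * (k * m mod 5) mod 5"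
      by (simp only: mod_mult_left_eq mod_mult_right_eq mult.assoc)
    then have "T i = T ((i * k mod 5) * m)" using k by (intro T_cong) simp
    then have "N (T i a) = u (i * k mod 5)" by (simp add: u_def)
    moreover have "i * k mod 5 < 5" by simp
    then have "i * k mod 5 = 0 \<or> i * k mod 5 = 1 \<or> i * k mod 5 = 2 \<or> i * k mod 5 = 3 \<or> i * k mod 5 = 4"
      by linarith
    ultimately show "k1 * N (T i a) $ 1 + k2 * N (T i a) $ 2 = 0"
      using u(1,2) that(2,3) 4 by (elim disjE) simp_all
  qed
  have indep: "c = 0 \<and> d = 0" if cd: "c *s u 2 + d *s u 3 = 0" for c d
  proof (rule ccontr)
    assume nz: "\<not> (c = 0 \<and> d = 0)"
    have comp: "c * u 2 $ i + d * u 3 $ i = 0" for i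
      using arg_cong[OF cd, of "\<lambda>v. v $ i"] by simp
    obtain k1 k2 where "k1 \<noteq> 0 \<or> k2 \<noteq> 0" "k1 * u 2 $ 1 + k2 * u 2 $ 2 = 0" "k1 * u 3 $ 1 + k2 * u 3 $ 2 = 0"
      using singular_kernel[OF comp comp] nz by blast
    then show False by (rule no_line)
  qed
  show ?thesis unfolding LP_plane_def
    using \<alpha> \<beta> a(2,3) u(3) indep unfolding u_def by blast
qed

text \<open>Here \<open>a\<close>, \<open>b\<close>, \<open>e\<close> represent A, B, E: the last
  two conclusions put \<open>e\<close> on the lines joining A to B and \<open>A\<^sub>1\<close> to
  \<open>B\<^sub>2\<close>.\<close>

lemma LP_planeE:
  assumes m: "\<not> 5 dvd m" and "LP_plane m"
  obtains a \<alpha> \<beta> e b where "e = \<alpha> *s T (2 * m) a + \<beta> *s T (4 * m) a" "a \<noteq> 0" "e \<noteq> 0" "b \<noteq> 0"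
    "N a = 0" "N (T m a) = 0" "N b = 0" "N (T (2 * m) b) = 0"
    "\<exists>c d. e = c *s a + d *s b" "\<exists>c d. e = c *s T m a + d *s T (2 * m) b"
proof -
  obtain a \<alpha> \<beta> where *: "\<alpha> \<noteq> 0" "\<beta> \<noteq> 0" "N a = 0" "N (T m a) = 0"
    "\<alpha> *s N (T (2 * m) a) + \<beta> *s N (T (4 * m) a) = 0"
    "\<And>c d. c *s N (T (2 * m) a) + d *s N (T (3 * m) a) = 0 \<Longrightarrow> c = 0 \<and> d = 0"
    using assms unfolding LP_plane_def by blast
  have T3: "N (T (3 * m) a) \<noteq> 0" using *(6)[of 0 1] by auto
  have Tc: "T m (T (2 * m) a) = T (3 * m) a" "T m (T (4 * m) a) = a"
    "T (2 * m) (T (2 * m) a) = T (4 * m) a" "T (2 * m) (T (4 * m) a) = T m a"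
    using T_mult_5[of m a] T_add_mult_5[of m m a] by (simp_all add: T_T)
  define e where "e = \<alpha> *s T (2 * m) a + \<beta> *s T (4 * m) a"
  \<comment> \<open>Chosen so that in \<open>T (2 * m) (x *s a + e)\<close> the terms at
    \<open>T (2 * m) a\<close> and \<open>T (4 * m) a\<close> combine to a multiple of
    \<open>e\<close>. The rest is a multiple of \<open>T m a\<close>, hence
    \<open>T (2 * m) b\<close> is in the kernel.\<close>
  define x where "x = fr (3 * m) (\<alpha> / \<beta>) * \<alpha>"
  define b where "b = x *s a + e"
  have x: "fr (2 * m) x = \<alpha> / \<beta> * fr (2 * m) \<alpha>"
    using fr_cong[of "2 * m + 3 * m" 0] by (simp add: x_def fr_mult fr_fr)
  have Te: "T (2 * m) e = fr (2 * m) \<alpha> *s T (4 * m) a + fr (2 * m) \<beta> *s T m a"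
    by (simp add: e_def T_add T_scale Tc)
  have Tb: "T (2 * m) b = (fr (2 * m) \<alpha> / \<beta>) *s e + fr (2 * m) \<beta> *s T m a"
    unfolding b_def T_add T_scale Te x using *(2)
    by (simp add: e_def vector_add_ldistrib algebra_simps)
  have Ne: "N e = 0" using *(5) by (simp add: e_def N_add N_scale)
  \<comment> \<open>After \<open>T m\<close>, only the term at \<open>T (3 * m) a\<close> survives
    \<open>N\<close>. The case y = 0 gives \<open>e\<close>, the case y = x gives
    \<open>b\<close>.\<close>
  have nz: "y *s a + e \<noteq> 0" for y
  proof
    assume "y *s a + e = 0"
    then have "N (T m (y *s a + e)) = 0" by simp
    then have "fr m \<alpha> *s N (T (3 * m) a) = 0"
      by (simp add: e_def T_add T_scale N_add N_scale Tc *)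
    then show False using T3 *(1) by simp
  qed
  show ?thesis
  proof (rule that[OF e_def])
    show "a \<noteq> 0" using T3 by auto
    show "e \<noteq> 0" using nz[of 0] by simp
    show "b \<noteq> 0" using nz by (simp add: b_def)
    show "N a = 0" "N (T m a) = 0" "N b = 0" "N (T (2 * m) b) = 0"
      unfolding Tb using * Ne by (simp_all add: b_def N_add N_scale)
    show "\<exists>c d. e = c *s a + d *s b" by (intro exI[of _ "-x"] exI[of _ 1]) (simp add: b_def)
    have "(\<beta> / fr (2 * m) \<alpha>) *s T (2 * m) b =
      e + (\<beta> / fr (2 * m) \<alpha> * fr (2 * m) \<beta>) *s T m a"
      unfolding Tb using *(1,2) by (simp add: vector_add_ldistrib)
    then have "e = (- (\<beta> / fr (2 * m) \<alpha> * fr (2 * m) \<beta>)) *s T m a + (\<beta> / fr (2 * m) \<alpha>) *s T (2 * m) b"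
      by simp
    then show "\<exists>c d. e = c *s T m a + d *s T (2 * m) b" by blast
  qed
qed

end

subsection \<open>Linear sets of LP type\<close>

lemma sum_comp_eq_if_equal_fibres:
  fixes h :: "'b \<Rightarrow> 'c::semiring_1"
  assumes "finite X" "f ` X = g ` X"
    and f: "\<And>y. y \<in> f ` X \<Longrightarrow> card {x \<in> X. f x = y} = k"
    and g: "\<And>y. y \<in> g ` X \<Longrightarrow> card {x \<in> X. g x = y} = k"
  shows "(\<Sum>x\<in>X. h (f x)) = (\<Sum>x\<in>X. h (g x))"
proof -
  have *: "(\<Sum>x\<in>X. h (f x)) = (\<Sum>y\<in>f ` X. of_nat k * h y)"
    if "\<And>y. y \<in> f ` X \<Longrightarrow> card {x \<in> X. f x = y} = k" for f
  proof -
    have "(\<Sum>x\<in>X. h (f x)) = (\<Sum>y\<in>f ` X. \<Sum>x\<in>{x \<in> X. f x = y}. h (f x))"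
      by (rule sum.image_gen) fact
    also have "\<dots> = (\<Sum>y\<in>f ` X. \<Sum>x\<in>{x \<in> X. f x = y}. h y)"
      by (intro sum.cong) auto
    also have "\<dots> = (\<Sum>y\<in>f ` X. of_nat k * h y)"
      by (intro sum.cong refl) (simp add: that)
    finally show ?thesis .
  qed
  show ?thesis using *[of f, OF f] *[of g, OF g] assms(2) by simp
qed

text \<open>The fibres partition \<open>X\<close>, so lower bounds that already add up to
  \<open>card X\<close> are all attained.\<close>

lemma equal_fibres_if_card:
  assumes "finite X" "card X = k * card (f ` X)"
    and ge: "\<And>y. y \<in> f ` X \<Longrightarrow> k \<le> card {x \<in> X. f x = y}" and "y \<in> f ` X"
  shows "card {x \<in> X. f x = y} = k"
proof -
  have "(\<Sum>y\<in>f ` X. k) = (\<Sum>y\<in>f ` X. card {x \<in> X. f x = y})"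
    using sum.image_gen[OF assms(1), of "\<lambda>_. 1::nat" f] assms(2) by (simp add: mult.commute)
  from sum_mono_inv[OF this ge assms(4)] assms(1) show ?thesis by simp
qed

context quintic_field
begin

lemma card_Fq_nonzero: "card (Fq q - {0::'a}) = q - 1"
  using card_Fq q_gt_1 by (simp add: Fq_def zero_power)

lemma card_multiples:
  fixes v :: "'a ^ 'n"
  assumes "v \<noteq> 0" shows "card ((\<lambda>c. c *s v) ` (Fq q - {0})) = q - 1"
proof -
  have "inj_on (\<lambda>c. c *s v) (Fq q - {0})" using assms by (auto simp: inj_on_def)
  then show ?thesis by (simp add: card_image card_Fq_nonzero)
qed

lemma card_multiples_field:
  assumes "(x::'a) \<noteq> 0" shows "card ((\<lambda>c. c * x) ` (Fq q - {0})) = q - 1"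
proof -
  have "inj_on (\<lambda>c. c * x) (Fq q - {0})" using assms by (auto simp: inj_on_def)
  then show ?thesis by (simp add: card_image card_Fq_nonzero)
qed

lemma lin_poly_scale: "c \<in> Fq q \<Longrightarrow> lin_poly s f (c * x) = c * lin_poly s f x"
  by (simp add: lin_poly_def fr_mult Fq_fr sum_distrib_left mult_ac)

end

context scattered_projection
begin

text \<open>\<open>N\<close> kills the terms of \<open>tr a\<close> at \<open>a\<close> and
  \<open>T m a\<close> and makes those at \<open>T (2 * m) a\<close> and \<open>T (4 * m) a\<close>
  parallel. The argument \<open>fr (2 * m) y\<close> is taken so that the remaining vector
  \<open>T (3 * m) a\<close> gets the coefficient \<open>y\<close>.\<close>

lemma LP_plane_imp_form:
  assumes m: "\<not> 5 dvd m" and "LP_plane m"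
  obtains u v \<delta> where "norm5 q \<delta> \<notin> {0, 1}"
    "\<And>c d. c *s u + d *s v = 0 \<Longrightarrow> c = 0 \<and> d = 0"
    "N ` (fixed - {0}) = {y *s u + (fr m y + \<delta> * fr (4 * m) y) *s v | y. y \<noteq> 0}"
proof -
  obtain a \<alpha> \<beta> where *: "\<alpha> \<noteq> 0" "\<beta> \<noteq> 0" "N a = 0" "N (T m a) = 0"
    "\<alpha> *s N (T (2 * m) a) + \<beta> *s N (T (4 * m) a) = 0"
    "\<And>c d. c *s N (T (2 * m) a) + d *s N (T (3 * m) a) = 0 \<Longrightarrow> c = 0 \<and> d = 0"
    using assms unfolding LP_plane_def by blast
  define \<gamma> where "\<gamma> = - \<alpha> / \<beta>"
  have \<gamma>: "\<gamma> \<noteq> 0" using *(1,2) by (simp add: \<gamma>_def)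
  have u4: "N (T (4 * m) a) = \<gamma> *s N (T (2 * m) a)"
  proof -
    have "\<beta> *s N (T (4 * m) a) = (- \<alpha>) *s N (T (2 * m) a)" using *(5) by (simp add: eq_neg_iff_add_eq_0 add.commute)
    then have "(1 / \<beta>) *s (\<beta> *s N (T (4 * m) a)) = (1 / \<beta>) *s ((- \<alpha>) *s N (T (2 * m) a))" by simp
    then show ?thesis using *(2) by (simp add: \<gamma>_def)
  qed
  define u where "u = N (T (3 * m) a)"
  define v where "v = \<gamma> *s N (T (2 * m) a)"
  define \<delta> where "\<delta> = 1 / \<gamma>"
  have indep: "c = 0 \<and> d = 0" if "c *s u + d *s v = 0" for c d
  proof -
    have "(d * \<gamma>) *s N (T (2 * m) a) + c *s N (T (3 * m) a) = 0"
      using that by (simp add: u_def v_def add.commute)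
    from *(6)[OF this] show ?thesis using \<gamma> by simp
  qed
  have red: "fr (k * m) = fr (l * m)" if "k mod 5 = l mod 5" for k l
    by (rule fr_cong) (metis that mod_mult_left_eq)
  have form: "N (tr a (fr (2 * m) y)) = y *s u + (fr m y + \<delta> * fr (4 * m) y) *s v" for y
  proof -
    have f: "fr (2 * m) (fr (2 * m) y) = fr (4 * m) y" "fr (3 * m) (fr (2 * m) y) = y"
      "fr (4 * m) (fr (2 * m) y) = fr m y"
      using red[of 5 0] red[of 6 1] by (simp_all add: fr_fr)
    have "N (tr a (fr (2 * m) y)) = fr (4 * m) y *s N (T (2 * m) a) + y *s u + (fr m y * \<gamma>) *s N (T (2 * m) a)"
      unfolding tr_expand[OF m] N_add N_scale f u4 *(3,4) u_def by simp
    also have "\<dots> = y *s u + (fr m y + \<delta> * fr (4 * m) y) *s v"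
      using \<gamma> by (simp add: v_def \<delta>_def algebra_simps flip: vec.scale_left_distrib)
    finally show ?thesis .
  qed
  have inj: "y = 0" if "tr a (fr (2 * m) y) = 0" for y
    using indep[of y "fr m y + \<delta> * fr (4 * m) y"] form[of y] that by simp
  have "inj (\<lambda>y. tr a (fr (2 * m) y))"
  proof (rule injI)
    fix x y assume "tr a (fr (2 * m) x) = tr a (fr (2 * m) y)"
    then have "tr a (fr (2 * m) (x - y)) = 0" by (simp add: fr_diff tr_diff)
    then show "x = y" using inj by fastforce
  qed
  then have "card (range (\<lambda>y. tr a (fr (2 * m) y))) = card fixed"
    using card_fixed by (simp add: card_image card_K fixed_def)
  \<comment> \<open>An injective map from the field into the q^5 fixed vectors is onto.\<close>
  then have surj: "range (\<lambda>y. tr a (fr (2 * m) y)) = fixed"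
    by (intro card_subset_eq) (auto simp: tr_fixed)
  \<comment> \<open>With norm 1, two fixed vectors have images with ratio \<open>z\<close> outside
    F_q, while scatteredness makes the ratio an element of F_q.\<close>
  have norm1: "norm5 q \<delta> \<noteq> 1"
  proof
    assume "norm5 q \<delta> = 1"
    then obtain x z where xz: "x \<noteq> 0" "z \<notin> Fq q"
      "(fr m (x * z) + \<delta> * fr (4 * m) (x * z)) * x = (fr m x + \<delta> * fr (4 * m) x) * (x * z)"
      using not_scattered_if_norm5_1[OF m] by blast
    have "z \<noteq> 0" using xz(2) q_gt_1 by (auto simp: Fq_def zero_power)
    let ?w = "\<lambda>y. tr a (fr (2 * m) y)"
    have nz: "?w x \<noteq> 0" "?w (x * z) \<noteq> 0" using inj[of x] inj[of "x * z"] xz(1) \<open>z \<noteq> 0\<close> by auto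
    have "fr m (x * z) + \<delta> * fr (4 * m) (x * z) = z * (fr m x + \<delta> * fr (4 * m) x)"
      using xz(1,3) by (simp add: mult_ac)
    then have Nz: "N (?w (x * z)) = z *s N (?w x)"
      unfolding form by (simp add: vector_add_ldistrib mult.commute)
    then obtain d where d: "d \<in> Fq q" "?w (x * z) = d *s ?w x"
      using scattered[of "?w (x * z)" "?w x" z] nz tr_fixed[of a] by (auto simp: fixed_def)
    then have "d *s N (?w x) = z *s N (?w x)" using Nz by (simp add: N_scale)
    then have "d = z" using fixed_N_nonzero[OF tr_fixed nz(1)] by simp
    then show False using d xz by simp
  qed
  have norm0: "norm5 q \<delta> \<noteq> 0" using \<gamma> by (simp add: norm5_def \<delta>_def)
  have "N ` (fixed - {0}) = {y *s u + (fr m y + \<delta> * fr (4 * m) y) *s v | y. y \<noteq> 0}"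
  proof (intro equalityI subsetI)
    fix z assume "z \<in> N ` (fixed - {0})"
    then obtain w where w: "w \<in> fixed" "w \<noteq> 0" "z = N w" by blast
    then obtain y where "w = tr a (fr (2 * m) y)" using surj by blast
    moreover from this have "y \<noteq> 0" using w(2) by (auto simp: tr_def)
    ultimately show "z \<in> {y *s u + (fr m y + \<delta> * fr (4 * m) y) *s v | y. y \<noteq> 0}"
      using form w(3) by blast
  next
    fix z assume "z \<in> {y *s u + (fr m y + \<delta> * fr (4 * m) y) *s v | y. y \<noteq> 0}"
    then obtain y where y: "y \<noteq> 0" "z = N (tr a (fr (2 * m) y))" using form by auto
    then show "z \<in> N ` (fixed - {0})" using inj[of y] tr_fixed by blast
  qed
  then show ?thesis using that[of \<delta> u v] norm0 norm1 indep by blast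
qed

text \<open>\<open>N'\<close> is \<open>N\<close> followed by a change of coordinates on the line,
  hence the same kernel. Only the point sets are known to agree, so the comparison of coefficients
  passes through sums over quotients of coordinates.\<close>

lemma form_imp_LP_plane:
  fixes N' :: "'a ^ 5 \<Rightarrow> 'a ^ 2"
  assumes s: "\<not> 5 dvd s" and \<delta>: "\<delta> \<noteq> 0"
    and N'_add: "\<And>v w. N' (v + w) = N' v + N' w" and N'_scale: "\<And>c v. N' (c *s v) = c *s N' v"
    and kernel: "\<And>v. N' v = 0 \<longleftrightarrow> N v = 0"
    and sub: "\<And>w. w \<in> fixed \<Longrightarrow> w \<noteq> 0 \<Longrightarrow>
      \<exists>x c. x \<noteq> 0 \<and> c \<noteq> 0 \<and> N' w = c *s vector [x, fr s x + \<delta> * fr (4 * s) x]"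
    and sup: "\<And>x. x \<noteq> 0 \<Longrightarrow>
      \<exists>w\<in>fixed - {0}. \<exists>c. c \<noteq> 0 \<and> N' w = c *s vector [x, fr s x + \<delta> * fr (4 * s) x]"
  shows "LP_plane s"
proof -
  define \<phi> where "\<phi> w = N' w $ 1" for w
  have \<phi>_add: "\<phi> (v + w) = \<phi> v + \<phi> w" and \<phi>_scale: "\<phi> (c *s v) = c * \<phi> v" for v w c
    by (simp_all add: \<phi>_def N'_add N'_scale)
  have N'_0: "N' 0 = 0" using N'_scale[of 0 0] by simp
  have N'_sum: "N' (sum f X) = (\<Sum>x\<in>X. N' (f x))" for f :: "'a ^ 5 \<Rightarrow> 'a ^ 5" and X
    by (induction X rule: infinite_finite_induct) (auto simp: N'_add N'_0)
  have N'_diff: "N' (v - w) = N' v - N' w" for v w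
    using N'_add[of "v - w" w] by (simp add: eq_diff_eq)
  have \<phi>_nz: "\<phi> w \<noteq> 0" if "w \<in> fixed" "w \<noteq> 0" for w
    using sub[OF that] by (auto simp: \<phi>_def)
  have inj_\<phi>: "inj_on \<phi> fixed"
  proof (rule inj_onI)
    fix v w assume "v \<in> fixed" "w \<in> fixed" "\<phi> v = \<phi> w"
    then have "v - w \<in> fixed" "\<phi> (v - w) = 0" by (auto simp: fixed_diff \<phi>_def N'_diff)
    then show "v = w" using \<phi>_nz[of "v - w"] by auto
  qed
  have bij_\<phi>: "bij_betw \<phi> (fixed - {0}) (UNIV - {0})"
  proof -
    have zero: "0 \<in> fixed" by (simp add: fixed_def)
    have inj: "inj_on \<phi> (fixed - {0})" using inj_\<phi> by (rule inj_on_subset) auto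
    have "card (fixed - {0}) = card (UNIV - {0::'a})"
      using card_fixed zero by (simp add: card_K fixed_def)
    then have "\<phi> ` (fixed - {0}) = UNIV - {0}"
      using inj \<phi>_nz by (intro card_subset_eq) (auto simp: card_image)
    then show ?thesis using inj by (simp add: bij_betw_def)
  qed
  \<comment> \<open>the vector for which \<open>tr p\<close> inverts \<open>\<phi>\<close> on the fixed vectors\<close>
  define p where "p = - (\<Sum>w\<in>fixed-{0}. (1 / \<phi> w) *s w)"
  have T_p: "T i p = - (\<Sum>w\<in>fixed-{0}. (1 / fr i (\<phi> w)) *s w)" for i
  proof -
    have "T i (- v) = - T i v" for v
      using T_scale[of i "-1" v] by (simp add: fr_uminus)
    then show ?thesis unfolding p_def
      by (simp add: T_sum T_scale fr_divide fixed_T)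
  qed
  \<comment> \<open>Reindexing along \<open>\<phi>\<close> gives the orthogonality relation, so
    \<open>N' (tr p x)\<close> has first coordinate \<open>x\<close>.\<close>
  have \<phi>_T_p: "\<phi> (T i p) = (if i mod 5 = 0 then 1 else 0)" for i
  proof -
    have "N' (- v) = - N' v" for v using N'_scale[of "-1" v] by simp
    then have "\<phi> (T i p) = - (\<Sum>w\<in>fixed-{0}. \<phi> w / fr i (\<phi> w))"
      unfolding T_p \<phi>_def by (simp add: N'_sum N'_scale)
    also have "(\<Sum>w\<in>fixed-{0}. \<phi> w / fr i (\<phi> w)) = (\<Sum>x\<in>UNIV-{0}. fr 0 x / fr i x)"
      using sum.reindex_bij_betw[OF bij_\<phi>, of "\<lambda>x. x / fr i x"] by simp
    finally show ?thesis unfolding fr_orthogonal by simp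
  qed
  \<comment> \<open>The coefficients of the polynomial that gives the second coordinate of
    \<open>N' (tr p x)\<close>.\<close>
  define b where "b i = N' (T (s * i) p) $ 2" for i
  have N'_tr: "N' (tr p x) = vector [x, lin_poly s b x]" for x
  proof -
    have nd: "s mod 5 \<noteq> 0" "2 * s mod 5 \<noteq> 0" "3 * s mod 5 \<noteq> 0" "4 * s mod 5 \<noteq> 0"
      using s not_dvd_mult_5[OF s, of 2] not_dvd_mult_5[OF s, of 3] not_dvd_mult_5[OF s, of 4]
      by (auto simp: dvd_eq_mod_eq_0)
    have "N' (tr p x) $ 1 = x"
      using \<phi>_T_p[of s] \<phi>_T_p[of "2 * s"] \<phi>_T_p[of "3 * s"] \<phi>_T_p[of "4 * s"] \<phi>_T_p[of 0] nd
      unfolding tr_expand[OF s] \<phi>_def by (simp add: N'_add N'_scale)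
    moreover have "N' (tr p x) $ 2 = lin_poly s b x"
      unfolding tr_expand[OF s] lin_poly_def sum_lessThan_5 b_def by (simp add: N'_add N'_scale mult.commute)
    ultimately show ?thesis by (simp add: vec_eq_iff forall_2)
  qed
  have tr_p: "tr p (\<phi> w) = w" if "w \<in> fixed" for w
    using inj_onD[OF inj_\<phi> _ tr_fixed that, of p "\<phi> w"] by (simp add: \<phi>_def N'_tr)
  define G where "G x = lin_poly s b x / x" for x
  define F where "F x = (fr s x + \<delta> * fr (4 * s) x) / x" for x
  let ?U = "UNIV - {0::'a}"
  \<comment> \<open>A point with nonzero first coordinate is determined by the quotient of its
    coordinates.\<close>
  have images: "G ` ?U = F ` ?U"
  proof (intro equalityI subsetI)
    fix y assume "y \<in> G ` ?U"
    then obtain x where x: "x \<noteq> 0" "y = lin_poly s b x / x" by (auto simp: G_def)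
    have "tr p x \<noteq> 0" using N'_tr[of x] x(1) by (metis N'_0 vector_2(1) zero_index)
    then obtain x' c where x': "x' \<noteq> 0" "c \<noteq> 0"
      "N' (tr p x) = c *s vector [x', fr s x' + \<delta> * fr (4 * s) x']"
      using sub[OF tr_fixed] by blast
    then have "x = c * x'" "lin_poly s b x = c * (fr s x' + \<delta> * fr (4 * s) x')"
      unfolding N'_tr by (auto simp: vec_eq_iff forall_2)
    then have "y = F x'" using x(2) x'(2) by (simp add: F_def)
    then show "y \<in> F ` ?U" using x'(1) by blast
  next
    fix y assume "y \<in> F ` ?U"
    then obtain x where x: "x \<noteq> 0" "y = F x" by auto
    obtain w c where w: "w \<in> fixed" "w \<noteq> 0" "c \<noteq> 0" "N' w = c *s vector [x, fr s x + \<delta> * fr (4 * s) x]"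
      using sup[OF x(1)] by blast
    then have "vector [\<phi> w, lin_poly s b (\<phi> w)] = c *s (vector [x, fr s x + \<delta> * fr (4 * s) x] :: 'a ^ 2)"
      using N'_tr[of "\<phi> w"] tr_p[OF w(1)] by simp
    then have "\<phi> w = c * x" "lin_poly s b (\<phi> w) = c * (fr s x + \<delta> * fr (4 * s) x)"
      by (auto simp: vec_eq_iff forall_2)
    then have "y = G (\<phi> w)" using x(2) w(3) by (simp add: F_def G_def)
    then show "y \<in> G ` ?U" using \<phi>_nz[OF w(1,2)] by blast
  qed
  have F_fibre: "q - 1 \<le> card {x \<in> ?U. F x = y}" if "y \<in> F ` ?U" for y
  proof -
    from that obtain x where x: "x \<noteq> 0" "y = F x" by auto
    have "(\<lambda>c. c * x) ` (Fq q - {0}) \<subseteq> {x \<in> ?U. F x = y}"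
      using x by (auto simp: F_def fr_mult Fq_fr simp flip: distrib_left)
        (simp add: Fq_fr field_simps)
    then have "card ((\<lambda>c. c * x) ` (Fq q - {0})) \<le> card {x \<in> ?U. F x = y}" by (intro card_mono) auto
    then show ?thesis by (simp add: card_multiples_field x(1))
  qed
  have G_fibre: "card {x \<in> ?U. G x = y} = q - 1" if "y \<in> G ` ?U" for y
  proof -
    from that obtain x where x: "x \<noteq> 0" "y = G x" by auto
    have "{x \<in> ?U. G x = y} = (\<lambda>c. c * x) ` (Fq q - {0})"
    proof (intro equalityI subsetI)
      fix z assume "z \<in> {x \<in> ?U. G x = y}"
      then have z: "z \<noteq> 0" "lin_poly s b z / z = lin_poly s b x / x" using x(2) by (auto simp: G_def)
      have tr_nz: "tr p t \<noteq> 0" if "t \<noteq> 0" for t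
        using N'_tr[of t] that by (metis N'_0 vector_2(1) zero_index)
      have "N' (tr p z) = (z / x) *s N' (tr p x)"
        unfolding N'_tr using z x(1) by (simp add: vec_eq_iff forall_2 field_simps)
      then have "N' (tr p z - (z / x) *s tr p x) = 0" by (simp add: N'_diff N'_scale)
      then have "N (tr p z - (z / x) *s tr p x) = 0" by (simp add: kernel)
      moreover have "N (tr p z) = N (tr p z - (z / x) *s tr p x) + N ((z / x) *s tr p x)"
        by (simp flip: N_add)
      ultimately have "N (tr p z) = (z / x) *s N (tr p x)" by (simp add: N_scale)
      then obtain d where d: "d \<in> Fq q" "tr p z = d *s tr p x"
        using scattered[of "tr p z" "tr p x" "z / x"] tr_fixed[of p] tr_nz z(1) x(1) by (auto simp: fixed_def)
      then have "N' (tr p z) = d *s N' (tr p x)" by (simp add: N'_scale)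
      then have "z = d * x" unfolding N'_tr by (simp add: vec_eq_iff forall_2)
      then show "z \<in> (\<lambda>c. c * x) ` (Fq q - {0})" using d(1) z(1) by auto
    next
      fix z assume "z \<in> (\<lambda>c. c * x) ` (Fq q - {0})"
      then show "z \<in> {x \<in> ?U. G x = y}" using x by (auto simp: G_def lin_poly_scale)
    qed
    then show ?thesis by (simp add: card_multiples_field x(1))
  qed
  \<comment> \<open>Scatteredness gives the exact fibres of \<open>G\<close>. As \<open>F\<close>
    has the same image and fibres at least that large, counting makes its fibres exact too.\<close>
  have "card ?U = (\<Sum>y\<in>G ` ?U. card {x \<in> ?U. G x = y})"
    using sum.image_gen[of ?U "\<lambda>_. 1::nat" G] by simp
  also have "\<dots> = (q - 1) * card (F ` ?U)" using G_fibre by (simp add: images)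
  finally have "card ?U = (q - 1) * card (F ` ?U)" .
  then have F_fibre': "card {x \<in> ?U. F x = y} = q - 1" if "y \<in> F ` ?U" for y
    using equal_fibres_if_card[of ?U "q - 1" F y] F_fibre that by auto
  have sums: "(\<Sum>x\<in>?U. h (G x)) = (\<Sum>x\<in>?U. h (F x))" for h :: "'a \<Rightarrow> 'a"
    by (rule sum_comp_eq_if_equal_fibres[OF _ images G_fibre F_fibre']) auto
  have b: "b 0 = 0" "b 2 = 0" "b 3 = 0" "b 1 \<noteq> 0" "b 4 \<noteq> 0"
    by (rule LP_coefficients[OF s \<delta>, of b], use sums in \<open>simp add: G_def F_def\<close>)+
  have N'_T: "N' (T (i * s) p) = vector [if i mod 5 = 0 then 1 else 0, b i]" for i
  proof -
    have "i * s mod 5 = 0 \<longleftrightarrow> i mod 5 = 0"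
      using not_dvd_mult_5[OF s, of i] by (auto simp: dvd_eq_mod_eq_0 dest!: dvd_mult2[of _ i s] simp flip: dvd_eq_mod_eq_0)
    then show ?thesis using \<phi>_T_p[of "i * s"]
      by (simp add: vec_eq_iff forall_2 b_def \<phi>_def mult.commute)
  qed
  \<comment> \<open>Since \<open>b 2\<close> and \<open>b 3\<close> vanish, places 2 and 3 of the
    orbit of \<open>p\<close> are the two consecutive points in the kernel.\<close>
  define a where "a = T (2 * s) p"
  have red: "T (k * s) = T (l * s)" if "k mod 5 = l mod 5" for k l
    by (rule T_cong) (metis that mod_mult_left_eq)
  have Ta: "T s a = T (3 * s) p" "T (2 * s) a = T (4 * s) p" "T (3 * s) a = T (0 * s) p" "T (4 * s) a = T (1 * s) p"
    using red[of 5 0] red[of 6 1] by (simp_all add: a_def T_T)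
  have N'_a: "N' a = 0" "N' (T s a) = 0" "N' (T (2 * s) a) = vector [0, b 4]"
    "N' (T (3 * s) a) = vector [1, 0]" "N' (T (4 * s) a) = vector [0, b 1]"
    unfolding Ta unfolding a_def N'_T using b by (simp_all add: vec_eq_iff forall_2)
  show ?thesis unfolding LP_plane_def
  proof (intro exI conjI allI impI)
    show "b 1 \<noteq> 0" "- b 4 \<noteq> 0" using b by auto
    show "N a = 0" "N (T s a) = 0" using N'_a by (auto simp flip: kernel)
    show "b 1 *s N (T (2 * s) a) + (- b 4) *s N (T (4 * s) a) = 0"
      unfolding N_scale[symmetric] N_add[symmetric] kernel[symmetric] N'_add N'_scale N'_a
      by (simp add: vec_eq_iff forall_2)
    fix c d
    assume "c *s N (T (2 * s) a) + d *s N (T (3 * s) a) = 0"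
    then have "c *s vector [0, b 4] + d *s (vector [1, 0] :: 'a ^ 2) = 0"
      unfolding N_scale[symmetric] N_add[symmetric] kernel[symmetric] N'_add N'_scale N'_a .
    then show "c = 0" "d = 0" using b(5) by (auto simp: vec_eq_iff forall_2)
  qed
qed

end

subsection \<open>Points, lines and collineations\<close>

lemma span_singleton_iff: "w \<in> vec.span {v} \<longleftrightarrow> (\<exists>c. w = c *s v)"
  by (auto simp: vec.span_singleton)

lemma span_singleton_subset_iff: "vec.subspace W \<Longrightarrow> vec.span {v} \<subseteq> W \<longleftrightarrow> v \<in> W"
  using vec.span_base[of v "{v}"] vec.span_minimal[of "{v}" W] by auto

lemma span_singleton_scale: "c \<noteq> 0 \<Longrightarrow> vec.span {c *s v} = vec.span {v}"
proof (intro equalityI subsetI)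
  fix w assume "c \<noteq> 0" "w \<in> vec.span {v}"
  then obtain d where "w = d *s v" by (auto simp: span_singleton_iff)
  then have "w = (d / c) *s (c *s v)" using \<open>c \<noteq> 0\<close> by simp
  then show "w \<in> vec.span {c *s v}" unfolding span_singleton_iff by blast
qed (auto simp: span_singleton_iff)

lemma span_singleton_eqD: "vec.span {v} = vec.span {w} \<Longrightarrow> \<exists>c. v = c *s w"
  using vec.span_base[of v "{v}"] by (auto simp: span_singleton_iff)

lemma pg_point_iff: "vec.span {v} \<in> pg_points \<longleftrightarrow> v \<noteq> 0"
proof
  assume "vec.span {v} \<in> pg_points"
  then obtain w where "w \<noteq> 0" "vec.span {v} = vec.span {w}" by (auto simp: pg_points_def)
  then show "v \<noteq> 0" using span_singleton_eqD[of w v] by auto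
qed (auto simp: pg_points_def)

lemma pg_pointE:
  assumes "P \<in> pg_points" obtains v where "v \<noteq> 0" "P = vec.span {v}"
  using assms by (auto simp: pg_points_def)

lemma image_span_singleton:
  assumes "\<And>c v. f (c *s v) = \<eta> c *s f v" "surj \<eta>"
  shows "f ` vec.span {v} = vec.span {f v}"
proof (intro equalityI subsetI)
  fix w assume "w \<in> vec.span {f v}"
  then obtain c where "w = c *s f v" by (auto simp: span_singleton_iff)
  moreover obtain d where "c = \<eta> d" using assms(2) by (auto simp: surj_def)
  ultimately have "w = f (d *s v)" by (simp add: assms(1))
  then show "w \<in> f ` vec.span {v}" by (auto simp: span_singleton_iff)
qed (auto simp: span_singleton_iff assms(1))

lemma image_matrix_span_singleton: "(\<lambda>v. M *v v) ` vec.span {v} = vec.span {M *v v}"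
  by (rule image_span_singleton[of _ "\<lambda>c. c"]) (simp_all add: vector_scalar_commute)

lemma pg_span_pair_iff:
  assumes "v \<noteq> 0"
  shows "vec.span {v} \<in> pg_span {vec.span {a}, vec.span {b}} \<longleftrightarrow> (\<exists>c d. v = c *s a + d *s b)"
proof -
  have "vec.span {v} \<in> pg_span {vec.span {a}, vec.span {b}} \<longleftrightarrow> v \<in> vec.span (vec.span {a} \<union> vec.span {b})"
    using assms by (simp add: pg_span_def pg_point_iff span_singleton_subset_iff)
  also have "\<dots> \<longleftrightarrow> (\<exists>c d. v = c *s a + d *s b)"
    by (auto simp: vec.span_Un vec.span_span span_singleton_iff)
  finally show ?thesis .
qed

lemma field_automorphism_inv:
  assumes "field_automorphism \<eta>"
  shows "field_automorphism (inv \<eta>)"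
  unfolding field_automorphism_def
proof (intro conjI allI)
  have bij: "bij \<eta>" and h: "\<And>x y. \<eta> (x + y) = \<eta> x + \<eta> y" "\<And>x y. \<eta> (x * y) = \<eta> x * \<eta> y"
    using assms by (auto simp: field_automorphism_def)
  show "bij (inv \<eta>)" using bij by (rule bij_imp_bij_inv)
  have surj: "\<eta> (inv \<eta> z) = z" and inj: "inv \<eta> (\<eta> z) = z" for z
    using bij by (simp_all add: bij_is_surj surj_f_inv_f bij_is_inj)
  show "inv \<eta> (x + y) = inv \<eta> x + inv \<eta> y" for x y
    using inj[of "inv \<eta> x + inv \<eta> y"] by (simp only: h surj)
  show "inv \<eta> (x * y) = inv \<eta> x * inv \<eta> y" for x y
    using inj[of "inv \<eta> x * inv \<eta> y"] by (simp only: h surj)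
qed

lemma field_automorphism_simps:
  assumes "field_automorphism \<eta>"
  shows "\<eta> (x + y) = \<eta> x + \<eta> y" "\<eta> (x * y) = \<eta> x * \<eta> y" "\<eta> 0 = 0" "\<eta> 1 = 1"
    "\<eta> x = 0 \<longleftrightarrow> x = 0" "\<eta> (x ^ n) = \<eta> x ^ n"
proof -
  have bij: "bij \<eta>" and h: "\<And>x y. \<eta> (x + y) = \<eta> x + \<eta> y" "\<And>x y. \<eta> (x * y) = \<eta> x * \<eta> y"
    using assms by (auto simp: field_automorphism_def)
  show "\<eta> (x + y) = \<eta> x + \<eta> y" "\<eta> (x * y) = \<eta> x * \<eta> y" by fact+
  show 0: "\<eta> 0 = 0" using h(1)[of 0 0] add_left_cancel[of "\<eta> 0" "\<eta> 0" 0] by simp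
  show iff: "\<eta> x = 0 \<longleftrightarrow> x = 0" for x using inj_eq[OF bij_is_inj[OF bij], of x 0] 0 by simp
  show 1: "\<eta> 1 = 1" using h(2)[of 1 1] iff[of 1] by simp
  show "\<eta> (x ^ n) = \<eta> x ^ n" by (induction n) (auto simp: h 1)
qed

context scattered_projection
begin

lemma fr_surj: "surj (fr k)"
proof (rule finite_UNIV_inj_surj)
  show "inj (fr k)" by (rule injI) simp
qed simp

lemma T_image_span: "T k ` vec.span {v} = vec.span {T k v}"
  by (rule image_span_singleton[OF T_scale fr_surj])

lemma T_image_T_image: "T k ` (T l ` X) = T (k + l) ` X"
  by (auto simp: image_image T_T)

lemma T_image_pg_point: "P \<in> pg_points \<Longrightarrow> T k ` P \<in> pg_points"
  by (auto elim!: pg_pointE simp: T_image_span pg_point_iff)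

section \<open>The plane \<Gamma>, its images and the diagonal points\<close>

definition plane :: "('a ^ 5) set set" where
  "plane = {P \<in> pg_points. P \<subseteq> {v. N v = 0}}"

lemma plane_iff: "vec.span {v} \<in> plane \<longleftrightarrow> v \<noteq> 0 \<and> N v = 0"
proof -
  have "vec.subspace {v. N v = 0}" by (rule vec.subspaceI) (auto simp: N_add N_scale)
  then show ?thesis by (auto simp: plane_def pg_point_iff span_singleton_subset_iff)
qed

lemma T_plane_iff:
  assumes "(k + l) mod 5 = 0"
  shows "vec.span {v} \<in> (`) (T k) ` plane \<longleftrightarrow> v \<noteq> 0 \<and> N (T l v) = 0"
proof
  assume "vec.span {v} \<in> (`) (T k) ` plane"
  then obtain P where P: "P \<in> plane" "vec.span {v} = T k ` P" by blast
  then obtain w where w: "w \<noteq> 0" "P = vec.span {w}" by (auto simp: plane_def elim: pg_pointE)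
  have "vec.span {v} = vec.span {T k w}" using P w by (simp add: T_image_span)
  then have "T l ` vec.span {v} = vec.span {T (l + k) w}" by (simp add: T_image_span T_T)
  moreover have "T (l + k) w = w" using assms T_cong[of "l + k" 0] by (simp add: add.commute)
  ultimately have "vec.span {T l v} = vec.span {w}" by (simp add: T_image_span)
  then have "vec.span {T l v} \<in> plane" using P(1) w(2) by simp
  then show "v \<noteq> 0 \<and> N (T l v) = 0" by (simp add: plane_iff)
next
  assume "v \<noteq> 0 \<and> N (T l v) = 0"
  then have "vec.span {T l v} \<in> plane" by (simp add: plane_iff)
  moreover have "T (k + l) v = v" using assms T_cong[of "k + l" 0] by simp
  then have "vec.span {v} = T k ` vec.span {T l v}" by (simp add: T_image_span T_T)
  ultimately show "vec.span {v} \<in> (`) (T k) ` plane" by blast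
qed

text \<open>A is the only point of the plane whose image under \<open>T m\<close> is again in the
  plane, and B the only one for \<open>T (2 * m)\<close>. This identifies the vectors of
  \<open>LP_planeE\<close> with A and B, and then their common line point with E.\<close>

lemma diagonal_point_iff_LP_plane:
  assumes m: "\<not> 5 dvd m"
    and A: "plane \<inter> (`) (T (4 * m)) ` plane = {A}"
    and B: "plane \<inter> (`) (T (3 * m)) ` plane = {B}"
    and E: "pg_span {A, B} \<inter> pg_span {T m ` A, T (2 * m) ` B} = {E}"
  shows "E \<in> pg_span {T (2 * m) ` A, T (4 * m) ` A} \<longleftrightarrow> LP_plane m"
proof -
  have A_iff: "A = vec.span {v}" if "v \<noteq> 0" "N v = 0" "N (T m v) = 0" for v
  proof -
    have "vec.span {v} \<in> plane \<inter> (`) (T (4 * m)) ` plane"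
      using that T_plane_iff[of "4 * m" m] by (simp add: plane_iff)
    then show ?thesis unfolding A by simp
  qed
  have B_iff: "B = vec.span {v}" if "v \<noteq> 0" "N v = 0" "N (T (2 * m) v) = 0" for v
  proof -
    have "vec.span {v} \<in> plane \<inter> (`) (T (3 * m)) ` plane"
      using that T_plane_iff[of "3 * m" "2 * m"] by (simp add: plane_iff)
    then show ?thesis unfolding B by simp
  qed
  have AB: "A \<in> plane \<inter> (`) (T (4 * m)) ` plane" "B \<in> plane" using A B by auto
  then obtain a b where ab: "a \<noteq> 0" "A = vec.span {a}" "b \<noteq> 0" "B = vec.span {b}"
    by (auto simp: plane_def elim!: pg_pointE)
  have a: "N a = 0" "N (T m a) = 0" and b: "N b = 0"
    using AB T_plane_iff[of "4 * m" m a] unfolding ab by (auto simp: plane_iff)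
  have "E \<in> pg_span {A, B}" using E by auto
  then obtain e where e: "e \<noteq> 0" "E = vec.span {e}" by (auto simp: pg_span_def elim: pg_pointE)
  show ?thesis
  proof
    assume "E \<in> pg_span {T (2 * m) ` A, T (4 * m) ` A}"
    then obtain \<alpha> \<beta> where \<alpha>\<beta>: "e = \<alpha> *s T (2 * m) a + \<beta> *s T (4 * m) a"
      unfolding e ab T_image_span pg_span_pair_iff[OF e(1)] by blast
    obtain c d where "e = c *s a + d *s b"
      using \<open>E \<in> pg_span {A, B}\<close> unfolding e ab pg_span_pair_iff[OF e(1)] by blast
    then have "N e = 0" by (simp add: N_add N_scale a b)
    show "LP_plane m"
    proof (rule LP_planeI[OF m ab(1) a])
      show "\<exists>c. w = c *s a" if "w \<noteq> 0" "N w = 0" "N (T m w) = 0" for w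
        using A_iff[OF that] ab(2) span_singleton_eqD[of w a] by simp
      show "\<alpha> *s T (2 * m) a + \<beta> *s T (4 * m) a \<noteq> 0" "N (\<alpha> *s T (2 * m) a + \<beta> *s T (4 * m) a) = 0"
        using \<alpha>\<beta> e(1) \<open>N e = 0\<close> by simp_all
    qed
  next
    assume "LP_plane m"
    from LP_planeE[OF m this] obtain a \<alpha> \<beta> e b where *:
      "e = \<alpha> *s T (2 * m) a + \<beta> *s T (4 * m) a" "a \<noteq> 0" "e \<noteq> 0" "b \<noteq> 0"
      "N a = 0" "N (T m a) = 0" "N b = 0" "N (T (2 * m) b) = 0"
      "\<exists>c d. e = c *s a + d *s b" "\<exists>c d. e = c *s T m a + d *s T (2 * m) b" .
    have A': "A = vec.span {a}" and B': "B = vec.span {b}"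
      using A_iff B_iff * by blast+
    have "vec.span {e} \<in> pg_span {A, B} \<inter> pg_span {T m ` A, T (2 * m) ` B}"
      using * by (simp add: A' B' T_image_span pg_span_pair_iff)
    then have "E = vec.span {e}" using E by simp
    then show "E \<in> pg_span {T (2 * m) ` A, T (4 * m) ` A}"
      unfolding A' T_image_span using pg_span_pair_iff[OF *(3)] *(1) by blast
  qed
qed

section \<open>Equivalence of the projected set with an LP set\<close>

definition line_set :: "('a ^ 2) set set" where
  "line_set = {vec.span {N v} | v. v \<in> fixed \<and> v \<noteq> 0}"

lemma line_set_pg_points: "line_set \<subseteq> pg_points"
  using fixed_N_nonzero by (auto simp: line_set_def pg_point_iff)

lemma LP_plane_imp_LP_type:
  assumes s: "\<not> 5 dvd s" and "LP_plane s"
  shows "LP_type q line_set"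
proof -
  \<comment> \<open>\<open>LP_type\<close> asks for an exponent below 5.\<close>
  define m where "m = s mod 5"
  have m: "\<not> 5 dvd m" "m < 5" "LP_plane m"
    using assms LP_plane_cong[of m s] by (auto simp: m_def dvd_eq_mod_eq_0)
  obtain u v \<delta> where uv: "norm5 q \<delta> \<notin> {0, 1}"
    "\<And>c d. c *s u + d *s v = 0 \<Longrightarrow> c = 0 \<and> d = 0"
    "N ` (fixed - {0}) = {y *s u + (fr m y + \<delta> * fr (4 * m) y) *s v | y. y \<noteq> 0}"
    by (rule LP_plane_imp_form[OF m(1,3)]) (rule that)
  \<comment> \<open>The inverse of this change of basis is the required equivalence.\<close>
  define G where "G z = z $ 1 *s u + z $ 2 *s v" for z :: "'a ^ 2"
  have G_add: "G (y + z) = G y + G z" and G_scale: "G (c *s z) = c *s G z" for y z c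
    by (simp_all add: G_def vec.scale_left_distrib vec.scale_right_distrib)
  have "inj G"
  proof (rule injI)
    fix y z assume "G y = G z"
    then have "(y $ 1 - z $ 1) *s u + (y $ 2 - z $ 2) *s v = 0"
      by (simp add: G_def vec.scale_left_diff_distrib algebra_simps)
    from uv(2)[OF this] show "y = z" by (simp add: vec_eq_iff forall_2)
  qed
  then have bij: "bij G" by (simp add: bij_def finite_UNIV_inj_surj)
  have inv: "inv G (G z) = z" "G (inv G z) = z" for z
    using bij by (simp_all add: bij_is_inj bij_is_surj surj_f_inv_f)
  have inv_scale: "inv G (c *s z) = c *s inv G z" for c z
    using inv(1)[of "c *s inv G z"] by (simp only: G_scale inv(2))
  have semilinear: "semilinear_bij (inv G)"
    unfolding semilinear_bij_def
  proof (intro conjI allI exI[of _ "\<lambda>c. c"])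
    show "bij (inv G)" using bij by (rule bij_imp_bij_inv)
    show "inv G (y + z) = inv G y + inv G z" for y z
      using inv(1)[of "inv G y + inv G z"] by (simp only: G_add inv(2))
    show "field_automorphism (\<lambda>c::'a. c)" by (auto simp: field_automorphism_def bij_def)
  qed (rule inv_scale)
  have img: "inv G ` vec.span {G z} = vec.span {z}" for z
    using image_span_singleton[of "inv G" "\<lambda>c. c" "G z"] inv_scale by (simp add: inv)
  let ?z = "\<lambda>y. vector [y, fr m y + \<delta> * fr (4 * m) y] :: 'a ^ 2"
  have "line_set = (\<lambda>w. vec.span {w}) ` (N ` (fixed - {0}))" by (auto simp: line_set_def)
  also have "\<dots> = {vec.span {G (?z y)} | y. y \<noteq> 0}"
    unfolding uv(3) by (auto simp: G_def)
  finally have L: "line_set = {vec.span {G (?z y)} | y. y \<noteq> 0}" .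
  have "(\<lambda>P\<in>pg_points. inv G ` P) ` line_set = (`) (inv G) ` line_set"
    by (intro image_cong refl) (use line_set_pg_points in auto)
  also have "\<dots> = {vec.span {?z y} | y. y \<noteq> 0}"
    unfolding L by (simp add: setcompr_eq_image image_image img)
  also have "\<dots> = {vec.span {vector [x, x ^ (q ^ m) + \<delta> * x ^ (q ^ (5 - m))]} | x. x \<noteq> 0}"
  proof -
    have "m = 1 \<or> m = 2 \<or> m = 3 \<or> m = 4" using m(1,2) by (auto simp: dvd_eq_mod_eq_0)
    then have "(5 - m) mod 5 = 4 * m mod 5" by auto
    then have "fr (4 * m) = fr (5 - m)" by (intro fr_cong) simp
    then show ?thesis by (simp add: fr_def)
  qed
  finally have "PGammaL_equivalent line_set
      {vec.span {vector [x, x ^ (q ^ m) + \<delta> * x ^ (q ^ (5 - m))]} | x. x \<noteq> 0}"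
    using semilinear unfolding PGammaL_equivalent_def PGammaL_def by blast
  moreover have "coprime m 5"
    using m(1) prime_imp_coprime[of "5::nat" m] by (simp add: coprime_commute)
  ultimately show ?thesis unfolding LP_type_def using m(2) uv(1) by blast
qed

text \<open>The equivalence \<open>f\<close> is only semilinear. Applying the inverse
  \<open>\<zeta>\<close> of its automorphism to the coordinates makes \<open>N'\<close> linear; as
  \<open>\<zeta>\<close> commutes with Frobenius, the target keeps its shape with
  \<open>\<zeta> \<delta>\<close> for \<open>\<delta>\<close>.\<close>

lemma LP_type_imp_LP_plane:
  assumes "LP_type q line_set"
  obtains s where "\<not> 5 dvd s" "LP_plane s"
proof -
  obtain s \<delta> where s: "s < 5" "coprime s 5" "norm5 q \<delta> \<notin> {0, 1}"
    "PGammaL_equivalent line_set {vec.span {vector [x, x ^ (q ^ s) + \<delta> * x ^ (q ^ (5 - s))]} | x. x \<noteq> 0}"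
    using assms unfolding LP_type_def by blast
  have s5: "\<not> 5 dvd s" using coprime_common_divisor[OF s(2), of 5] by auto
  have \<delta>: "\<delta> \<noteq> 0" using s(3) by (auto simp: norm5_def)
  define F where "F x = (vector [x, fr s x + \<delta> * fr (4 * s) x] :: 'a ^ 2)" for x
  have F_eq: "{vec.span {vector [x, x ^ (q ^ s) + \<delta> * x ^ (q ^ (5 - s))]} | x. x \<noteq> 0} =
       {vec.span {F x} | x. x \<noteq> 0}"
  proof -
    have "s = 1 \<or> s = 2 \<or> s = 3 \<or> s = 4" using s5 s(1) by (auto simp: dvd_eq_mod_eq_0)
    then have "(5 - s) mod 5 = 4 * s mod 5" by auto
    then have "fr (4 * s) = fr (5 - s)" by (intro fr_cong) simp
    then show ?thesis by (simp add: F_def fr_def)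
  qed
  obtain f where f: "semilinear_bij f" "(\<lambda>P\<in>pg_points. f ` P) ` line_set = {vec.span {F x} | x. x \<noteq> 0}"
    using s(4) unfolding F_eq PGammaL_equivalent_def PGammaL_def by blast
  obtain \<eta> where \<eta>: "field_automorphism \<eta>" "\<And>c v. f (c *s v) = \<eta> c *s f v"
    and f_add: "\<And>u v. f (u + v) = f u + f v" and f_bij: "bij f"
    using f(1) unfolding semilinear_bij_def by blast
  define \<zeta> where "\<zeta> = inv \<eta>"
  have \<zeta>: "field_automorphism \<zeta>" unfolding \<zeta>_def by (rule field_automorphism_inv[OF \<eta>(1)])
  note \<zeta>_simps = field_automorphism_simps[OF \<zeta>]
  have \<eta>_bij: "bij \<eta>" using \<eta>(1) by (simp add: field_automorphism_def)
  have \<zeta>_\<eta>: "\<zeta> (\<eta> c) = c" for c using \<eta>_bij by (simp add: \<zeta>_def bij_is_inj)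
  have f_span: "f ` vec.span {v} = vec.span {f v}" for v
    by (rule image_span_singleton[OF \<eta>(2) bij_is_surj[OF \<eta>_bij]])
  have f_0: "f 0 = 0" using f_add[of 0 0] add_left_cancel[of "f 0" "f 0" 0] by simp
  have f_eq_0: "f v = 0 \<longleftrightarrow> v = 0" for v using inj_eq[OF bij_is_inj[OF f_bij], of v 0] f_0 by simp
  have L: "{vec.span {f (N w)} | w. w \<in> fixed \<and> w \<noteq> 0} = {vec.span {F x} | x. x \<noteq> 0}"
  proof -
    have "(\<lambda>P\<in>pg_points. f ` P) ` line_set = (`) f ` line_set"
      by (intro image_cong refl) (use line_set_pg_points in auto)
    also have "\<dots> = {vec.span {f (N w)} | w. w \<in> fixed \<and> w \<noteq> 0}"
      unfolding line_set_def by (simp add: setcompr_eq_image image_image f_span)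
    finally show ?thesis using f(2) by simp
  qed
  define N' where "N' w = (\<chi> i. \<zeta> (f (N w) $ i))" for w
  define \<delta>' where "\<delta>' = \<zeta> \<delta>"
  have \<zeta>_fr: "\<zeta> (fr k x) = fr k (\<zeta> x)" for k x by (simp add: fr_def \<zeta>_simps)
  have transfer: "N' w = \<zeta> c *s vector [\<zeta> x, fr s (\<zeta> x) + \<delta>' * fr (4 * s) (\<zeta> x)]"
    if "f (N w) = c *s F x" for w c x
    by (simp add: N'_def that vec_eq_iff forall_2 F_def \<zeta>_simps \<zeta>_fr \<delta>'_def)
  have "LP_plane s"
  proof (rule form_imp_LP_plane[OF s5, of \<delta>' N'])
    show "\<delta>' \<noteq> 0" using \<delta> by (simp add: \<delta>'_def \<zeta>_simps)
    show "N' (v + w) = N' v + N' w" for v w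
      by (simp add: N'_def vec_eq_iff N_add f_add \<zeta>_simps)
    show "N' (c *s v) = c *s N' v" for c v
      by (simp add: N'_def vec_eq_iff N_scale \<eta>(2) \<zeta>_simps \<zeta>_\<eta>)
    show "N' v = 0 \<longleftrightarrow> N v = 0" for v
    proof -
      have "N' v = 0 \<longleftrightarrow> f (N v) = 0" by (simp add: N'_def vec_eq_iff \<zeta>_simps)
      then show ?thesis by (simp add: f_eq_0)
    qed
    show "\<exists>x c. x \<noteq> 0 \<and> c \<noteq> 0 \<and> N' w = c *s vector [x, fr s x + \<delta>' * fr (4 * s) x]"
      if w: "w \<in> fixed" "w \<noteq> 0" for w
    proof -
      have "vec.span {f (N w)} \<in> {vec.span {F x} | x. x \<noteq> 0}" unfolding L[symmetric] using w by blast
      then obtain x where x: "x \<noteq> 0" "vec.span {f (N w)} = vec.span {F x}" by blast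
      then obtain c where c: "f (N w) = c *s F x" using span_singleton_eqD by blast
      then have "c \<noteq> 0" using f_eq_0[of "N w"] fixed_N_nonzero[OF w] by auto
      then show ?thesis using transfer[OF c] x(1)
        by (intro exI[of _ "\<zeta> x"] exI[of _ "\<zeta> c"]) (simp add: \<zeta>_simps)
    qed
    show "\<exists>w\<in>fixed - {0}. \<exists>c. c \<noteq> 0 \<and> N' w = c *s vector [x, fr s x + \<delta>' * fr (4 * s) x]"
      if x: "x \<noteq> 0" for x
    proof -
      have "\<eta> x \<noteq> 0" using x \<zeta>_\<eta>[of x] \<zeta>_simps(3) by auto
      then have "vec.span {F (\<eta> x)} \<in> {vec.span {f (N w)} | w. w \<in> fixed \<and> w \<noteq> 0}"
        unfolding L by blast
      then obtain w where w: "w \<in> fixed" "w \<noteq> 0" "vec.span {F (\<eta> x)} = vec.span {f (N w)}" by blast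
      then obtain c where c: "f (N w) = c *s F (\<eta> x)" using span_singleton_eqD[OF w(3)[symmetric]] by blast
      then have "c \<noteq> 0" using f_eq_0[of "N w"] fixed_N_nonzero[OF w(1,2)] by auto
      then show ?thesis using transfer[OF c] w(1,2)
        by (intro bexI[of _ w] exI[of _ "\<zeta> c"]) (simp_all add: \<zeta>_simps \<zeta>_\<eta>)
    qed
  qed
  then show ?thesis using that s5 by blast
qed

text \<open>Up to sign, \<open>m\<close> and \<open>2 * m\<close> represent all nonzero residues
  modulo 5, and \<open>LP_plane_inverse\<close> takes care of the sign.\<close>

lemma LP_plane_cases:
  assumes m: "\<not> 5 dvd m"
  shows "(\<exists>s. \<not> 5 dvd s \<and> LP_plane s) \<longleftrightarrow> LP_plane m \<or> LP_plane (2 * m)"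
proof
  assume "\<exists>s. \<not> 5 dvd s \<and> LP_plane s"
  then obtain s where s: "\<not> 5 dvd s" "LP_plane s" by blast
  obtain k where k: "k * m mod 5 = 1" using exists_inverse_mod_5[OF m] .
  define j where "j = s * k mod 5"
  have jm: "j * m mod 5 = s mod 5"
  proof -
    have "j * m mod 5 = s * (k * m mod 5) mod 5"
      by (simp only: j_def mod_mult_left_eq mod_mult_right_eq mult.assoc)
    then show ?thesis using k by simp
  qed
  have "j < 5" by (simp add: j_def)
  moreover have "j \<noteq> 0"
  proof
    assume "j = 0"
    then show False using jm s(1) by (simp add: dvd_eq_mod_eq_0)
  qed
  ultimately consider "j = 1" | "j = 2" | "j = 3" | "j = 4" by linarith
  then show "LP_plane m \<or> LP_plane (2 * m)"
  proof cases
    case 1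
    then show ?thesis using jm s(2) LP_plane_cong[of m s] by simp
  next
    case 2
    then show ?thesis using jm s(2) LP_plane_cong[of "2 * m" s] by simp
  next
    case 3
    have "4 * s mod 5 = 4 * (3 * m) mod 5" using jm 3 by (metis (no_types) mod_mult_right_eq)
    also have "4 * (3 * m) = 2 * m + 5 * (2 * m)" by simp
    finally have "4 * s mod 5 = 2 * m mod 5" by (simp only: mod_mult_self2)
    then show ?thesis using LP_plane_inverse[OF s(2)] LP_plane_cong[of "4 * s" "2 * m"] by simp
  next
    case 4
    have "4 * s mod 5 = 4 * (4 * m) mod 5" using jm 4 by (metis (no_types) mod_mult_right_eq)
    also have "4 * (4 * m) = m + 5 * (3 * m)" by simp
    finally have "4 * s mod 5 = m mod 5" by (simp only: mod_mult_self2)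
    then show ?thesis using LP_plane_inverse[OF s(2)] LP_plane_cong[of "4 * s" m] by simp
  qed
next
  assume "LP_plane m \<or> LP_plane (2 * m)"
  then show "\<exists>s. \<not> 5 dvd s \<and> LP_plane s"
    using m not_dvd_mult_5[OF m, of 2] by auto
qed

lemma LP_type_iff_LP_plane:
  assumes "\<not> 5 dvd m"
  shows "LP_type q line_set \<longleftrightarrow> LP_plane m \<or> LP_plane (2 * m)"
  unfolding LP_plane_cases[OF assms, symmetric]
  using LP_plane_imp_LP_type LP_type_imp_LP_plane by blast

text \<open>\<open>diagonal_point_iff_LP_plane\<close> is applied to \<open>m\<close> and to
  \<open>2 * m\<close>; in the second case B, \<open>A\<^sub>1\<close>, F take the places of A, B,
  E.\<close>

lemma LP_type_iff_diagonal_points: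
  assumes m: "\<not> 5 dvd m"
    and A: "plane \<inter> (`) (T (4 * m)) ` plane = {A}"
    and B: "plane \<inter> (`) (T (3 * m)) ` plane = {B}"
    and E: "pg_span {A, B} \<inter> pg_span {T m ` A, T (2 * m) ` B} = {E}"
    and F: "pg_span {A, T (2 * m) ` B} \<inter> pg_span {T m ` A, B} = {F}"
  shows "LP_type q line_set \<longleftrightarrow>
    E \<in> pg_span {T (2 * m) ` A, T (4 * m) ` A} \<or> F \<in> pg_span {T (3 * m) ` B, T (4 * m) ` B}"
proof -
  have red: "T (k * m) = T (l * m)" if "k mod 5 = l mod 5" for k l
    by (rule T_cong) (metis that mod_mult_left_eq)
  have T5: "T (5 * m) ` X = X" for X by simp
  have "(`) (T m) ` (plane \<inter> (`) (T (4 * m)) ` plane) = (`) (T m) ` plane \<inter> (`) (T m) ` (`) (T (4 * m)) ` plane"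
  proof (rule image_Int)
    have "T (4 * m) ` T m ` X = X" for X
      using T5[of X] by (simp add: T_image_T_image)
    then show "inj ((`) (T m))" by (intro inj_on_inverseI)
  qed
  moreover have "(`) (T m) ` (`) (T (4 * m)) ` plane = plane"
    using T5 by (simp add: image_image T_T)
  ultimately have A1: "plane \<inter> (`) (T m) ` plane = {T m ` A}" unfolding A by auto
  have m2: "\<not> 5 dvd 2 * m" using not_dvd_mult_5[OF m, of 2] by simp
  have T6: "T (3 * (2 * m)) = T m" using red[of 6 1] by simp
  have T8: "T (4 * (2 * m)) = T (3 * m)" using red[of 8 3] by simp
  have T4: "T (2 * (2 * m)) ` T m ` A = A" "T (2 * (2 * m)) = T (4 * m)"
    using T5[of A] by (simp_all add: T_image_T_image)
  have "F \<in> pg_span {T (2 * (2 * m)) ` B, T (4 * (2 * m)) ` B} \<longleftrightarrow> LP_plane (2 * m)"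
  proof (rule diagonal_point_iff_LP_plane[OF m2, where B = "T m ` A"])
    show "plane \<inter> (`) (T (4 * (2 * m))) ` plane = {B}" unfolding T8 by (rule B)
    show "plane \<inter> (`) (T (3 * (2 * m))) ` plane = {T m ` A}" unfolding T6 by (rule A1)
    show "pg_span {B, T m ` A} \<inter> pg_span {T (2 * m) ` B, T (2 * (2 * m)) ` T m ` A} = {F}"
      unfolding T4(1) using F by (simp add: insert_commute Int_commute)
  qed
  then have "F \<in> pg_span {T (3 * m) ` B, T (4 * m) ` B} \<longleftrightarrow> LP_plane (2 * m)"
    unfolding T8 T4(2) by (simp add: insert_commute)
  then show ?thesis
    using LP_type_iff_LP_plane[OF m] diagonal_point_iff_LP_plane[OF m A B E] by simp
qed

end

section \<open>From the geometric data to a scattered projection\<close>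

lemma card_vectors_over:
  "card {w :: 'a ^ 'n. \<forall>i. w $ i \<in> X} = card X ^ CARD('n)"
proof -
  have "bij_betw vec_nth {w :: 'a ^ 'n. \<forall>i. w $ i \<in> X} (PiE UNIV (\<lambda>_. X))"
    by (rule bij_betwI[where g = vec_lambda]) (auto simp: vec_eq_iff)
  then have "card {w :: 'a ^ 'n. \<forall>i. w $ i \<in> X} = card (PiE (UNIV :: 'n set) (\<lambda>_. X))"
    by (rule bij_betw_same_card)
  then show ?thesis by (simp add: card_PiE)
qed

lemma complement_projection:
  fixes W W' :: "('a::field ^ 'n) set"
  assumes W: "vec.subspace W" and W': "vec.subspace W'"
    and dim: "vec.dim W + vec.dim W' = CARD('n)" and Int: "W \<inter> W' = {0}"
  obtains pr where "\<And>u v. pr (u + v) = pr u + pr v" "\<And>c v. pr (c *s v) = c *s pr v"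
    "\<And>v. pr v \<in> W'" "\<And>v. v - pr v \<in> W" "\<And>v. v \<in> W \<Longrightarrow> pr v = 0" "\<And>v. v \<in> W' \<Longrightarrow> pr v = v"
proof -
  let ?sum = "{x + y | x y. x \<in> W \<and> y \<in> W'}"
  have "vec.dim ?sum + vec.dim (W \<inter> W') = vec.dim W + vec.dim W'"
    by (rule vec.dim_sums_Int[OF W W'])
  then have "vec.dim ?sum = CARD('n)" unfolding Int using dim by simp
  then have sum_UNIV: "?sum = UNIV"
    by (intro vec.subspace_dim_equal vec.subspace_sums[OF W W']) (simp_all add: card_cart_basis)
  then have "\<exists>y. y \<in> W' \<and> v - y \<in> W" for v
  proof -
    have "v \<in> ?sum" unfolding sum_UNIV by simp
    then obtain x y where "v = x + y" "x \<in> W" "y \<in> W'" by blast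
    then show ?thesis by (intro exI[of _ y]) simp
  qed
  then obtain pr where pr: "\<And>v. pr v \<in> W'" "\<And>v. v - pr v \<in> W" by metis
  have unique: "pr v = y" if "y \<in> W'" "v - y \<in> W" for v y
  proof -
    have "(v - y) - (v - pr v) \<in> W" using pr(2) that(2) by (rule vec.subspace_diff[OF W, rotated])
    then have "pr v - y \<in> W" by simp
    moreover have "pr v - y \<in> W'" using pr(1) that(1) by (rule vec.subspace_diff[OF W'])
    ultimately have "pr v - y \<in> W \<inter> W'" by simp
    then show ?thesis unfolding Int by simp
  qed
  show ?thesis
  proof (rule that[of pr])
    show "pr (u + v) = pr u + pr v" for u v
    proof (rule unique)
      show "pr u + pr v \<in> W'" using pr(1) pr(1) by (rule vec.subspace_add[OF W'])
      have "(u - pr u) + (v - pr v) \<in> W" using pr(2) pr(2) by (rule vec.subspace_add[OF W])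
      then show "u + v - (pr u + pr v) \<in> W" by (simp add: algebra_simps)
    qed
    show "pr (c *s v) = c *s pr v" for c v
    proof (rule unique)
      show "c *s pr v \<in> W'" using pr(1) by (rule vec.subspace_scale[OF W'])
      have "c *s (v - pr v) \<in> W" using pr(2) by (rule vec.subspace_scale[OF W])
      then show "c *s v - c *s pr v \<in> W" by (simp add: vec.scale_right_diff_distrib)
    qed
    show "pr v \<in> W'" "v - pr v \<in> W" for v by (fact pr)+
    show "pr v = 0" if "v \<in> W" for v
      using that vec.subspace_0[OF W'] by (intro unique) auto
    show "pr v = v" if "v \<in> W'" for v
      using that vec.subspace_0[OF W] by (intro unique) auto
  qed
qed

context quintic_field
begin

text \<open>Coordinatewise Frobenius in the frame given by the columns of \<open>M\<close>, where
  \<open>M'\<close> is meant to be the inverse of \<open>M\<close>.\<close>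

definition conj_fr :: "'a ^ 'n ^ 'n \<Rightarrow> 'a ^ 'n ^ 'n \<Rightarrow> nat \<Rightarrow> 'a ^ 'n \<Rightarrow> 'a ^ 'n" where
  "conj_fr M M' k v = M *v (\<chi> i. fr k ((M' *v v) $ i))"

lemma conj_fr_fixed_iff:
  assumes "M ** M' = mat 1" "M' ** M = mat 1"
  shows "conj_fr M M' 1 v = v \<longleftrightarrow> (\<forall>i. (M' *v v) $ i \<in> Fq q)"
proof -
  have MM': "M *v (M' *v w) = w" "M' *v (M *v w) = w" for w
    using assms by (simp_all add: matrix_vector_mul_assoc)
  have "conj_fr M M' 1 v = v \<longleftrightarrow> (\<chi> i. fr 1 ((M' *v v) $ i)) = M' *v v"
    unfolding conj_fr_def by (metis MM')
  also have "\<dots> \<longleftrightarrow> (\<forall>i. (M' *v v) $ i \<in> Fq q)" by (simp add: vec_eq_iff Fq_iff)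
  finally show ?thesis .
qed

text \<open>The q^5 - 1 nonzero fixed vectors are spread over \<open>norm_exp\<close> points, and
  each fibre contains the q - 1 nonzero F_q-multiples of a vector. The count leaves room for nothing
  else.\<close>

lemma scattered_projection_conj_fr:
  fixes M M' :: "'a ^ 5 ^ 5" and N :: "'a ^ 5 \<Rightarrow> 'a ^ 2"
  assumes MM': "M ** M' = mat 1" "M' ** M = mat 1"
    and N_add: "\<And>u v. N (u + v) = N u + N v" and N_scale: "\<And>c v. N (c *s v) = c *s N v"
    and nz: "\<And>v. conj_fr M M' 1 v = v \<Longrightarrow> v \<noteq> 0 \<Longrightarrow> N v \<noteq> 0"
    and card: "card {vec.span {N v} | v. conj_fr M M' 1 v = v \<and> v \<noteq> 0} = (q ^ 5 - 1) div (q - 1)"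
  shows "scattered_projection q (conj_fr M M') N"
proof -
  let ?T = "conj_fr M M'"
  have inv: "M *v (M' *v w) = w" "M' *v (M *v w) = w" for w
    using MM' by (simp_all add: matrix_vector_mul_assoc)
  have T_add: "?T k (u + v) = ?T k u + ?T k v" for k u v
  proof -
    have "(\<chi> i. fr k ((M' *v (u + v)) $ i)) = (\<chi> i. fr k ((M' *v u) $ i)) + (\<chi> i. fr k ((M' *v v) $ i))"
      by (simp add: vec_eq_iff matrix_vector_right_distrib fr_add)
    then show ?thesis by (simp add: conj_fr_def matrix_vector_right_distrib)
  qed
  have T_scale: "?T k (c *s v) = fr k c *s ?T k v" for k c v
  proof -
    have "(\<chi> i. fr k ((M' *v (c *s v)) $ i)) = fr k c *s (\<chi> i. fr k ((M' *v v) $ i))"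
      by (simp add: vec_eq_iff vector_scalar_commute fr_mult)
    then show ?thesis by (simp add: conj_fr_def vector_scalar_commute)
  qed
  let ?V = "{v. ?T 1 v = v}"
  have card_V: "card ?V = q ^ 5"
  proof -
    have "bij_betw (\<lambda>v. M' *v v) ?V {w. \<forall>i. w $ i \<in> Fq q}"
      by (rule bij_betwI[where g = "\<lambda>w. M *v w"]) (auto simp: conj_fr_fixed_iff[OF MM'] inv simp del: One_nat_def)
    then have "card ?V = card {w :: 'a ^ 5. \<forall>i. w $ i \<in> Fq q}" by (rule bij_betw_same_card)
    then show ?thesis by (simp add: card_vectors_over card_Fq)
  qed
  have scat: "\<exists>d\<in>Fq q. v = d *s w"
    if vw: "?T 1 v = v" "?T 1 w = w" "v \<noteq> 0" "w \<noteq> 0" "N v = c *s N w" for v w c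
  proof -
    let ?X = "?V - {0}" and ?f = "\<lambda>v. vec.span {N v}"
    have multiples: "(\<lambda>d. d *s u) ` (Fq q - {0}) \<subseteq> {x \<in> ?X. ?f x = ?f u}" if "u \<in> ?X" for u
      using that by (auto simp: T_scale Fq_fr N_scale span_singleton_scale)
    have "{vec.span {N v} | v. ?T 1 v = v \<and> v \<noteq> 0} = ?f ` ?X" by auto
    then have card_img: "card (?f ` ?X) = norm_exp" using card norm_exp(2) by simp
    have T_0: "?T 1 0 = 0" using T_scale[of 1 0 0] by simp
    have "card ?X = q ^ 5 - 1" using card_V T_0 by simp
    also have "\<dots> = (q - 1) * card (?f ` ?X)" by (simp only: card_img norm_exp(1))
    finally have card_X: "card ?X = (q - 1) * card (?f ` ?X)" .
    have "card {x \<in> ?X. ?f x = ?f w} = q - 1"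
    proof (rule equal_fibres_if_card[OF _ card_X])
      fix y assume "y \<in> ?f ` ?X"
      then obtain u where u: "u \<in> ?X" "y = ?f u" by blast
      have "q - 1 = card ((\<lambda>d. d *s u) ` (Fq q - {0}))" using u(1) by (simp add: card_multiples)
      also have "\<dots> \<le> card {x \<in> ?X. ?f x = y}"
        using multiples[OF u(1)] u(2) by (intro card_mono) auto
      finally show "q - 1 \<le> card {x \<in> ?X. ?f x = y}" .
    qed (use vw in auto)
    then have "(\<lambda>d. d *s w) ` (Fq q - {0}) = {x \<in> ?X. ?f x = ?f w}"
      using multiples[of w] vw by (intro card_subset_eq) (auto simp: card_multiples)
    moreover have "c \<noteq> 0" using nz[OF vw(1,3)] vw(5) by auto
    then have "v \<in> {x \<in> ?X. ?f x = ?f w}" using vw by (simp add: span_singleton_scale)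
    ultimately show ?thesis by blast
  qed
  show ?thesis
  proof (unfold_locales)
    show "?T k (u + v) = ?T k u + ?T k v" for k u v by (rule T_add)
    show "?T k (c *s v) = fr k c *s ?T k v" for k c v by (rule T_scale)
    show "?T k (?T l v) = ?T (k + l) v" for k l v by (simp add: conj_fr_def inv fr_fr)
    show "?T 0 v = v" "?T 5 v = v" for v by (simp_all add: conj_fr_def inv vec_nth_inverse)
    show "card ?V = q ^ 5" by (rule card_V)
  qed (fact N_add N_scale nz scat)+
qed

text \<open>In the frame of \<open>M\<close>, the basis points make the map diagonal, the all-one
  point makes the diagonal constant, and the remaining points force the automorphism to fix
  F_q.\<close>

lemma collineation_fixing_subgeometry:
  fixes M M' :: "'a ^ 5 ^ 5"
  assumes MM': "M ** M' = mat 1" "M' ** M = mat 1" and f: "semilinear_bij f"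
    and fixes_S: "\<And>v. v \<noteq> 0 \<Longrightarrow> (\<And>i. v $ i \<in> Fq q) \<Longrightarrow> f ` vec.span {M *v v} = vec.span {M *v v}"
  obtains m c where "m < 5" "c \<noteq> 0" "\<And>v. f v = c *s conj_fr M M' m v"
proof -
  have inv: "M *v (M' *v w) = w" "M' *v (M *v w) = w" for w
    using MM' by (simp_all add: matrix_vector_mul_assoc)
  obtain \<eta> where \<eta>: "field_automorphism \<eta>" "\<And>c v. f (c *s v) = \<eta> c *s f v"
    and f_add: "\<And>u v. f (u + v) = f u + f v" and f_bij: "bij f"
    using f unfolding semilinear_bij_def by blast
  note \<eta>_simps = field_automorphism_simps[OF \<eta>(1)]
  define h where "h v = M' *v f (M *v v)" for v
  have h_add: "h (u + v) = h u + h v" and h_scale: "h (c *s v) = \<eta> c *s h v" for u v c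
    by (simp_all add: h_def matrix_vector_right_distrib f_add vector_scalar_commute \<eta>(2))
  have h_0: "h 0 = 0" using h_scale[of 0 0] by (simp add: \<eta>_simps)
  have h_sum: "h (sum g X) = (\<Sum>x\<in>X. h (g x))" for g :: "5 \<Rightarrow> 'a ^ 5" and X
    by (induction X rule: infinite_finite_induct) (auto simp: h_add h_0)
  have h_fix: "\<exists>c. h v = c *s v" if v: "v \<noteq> 0" "\<And>i. v $ i \<in> Fq q" for v
  proof -
    have "f (M *v v) \<in> f ` vec.span {M *v v}" using vec.span_base[of "M *v v"] by blast
    then obtain c where "f (M *v v) = c *s (M *v v)"
      using fixes_S[OF v] by (auto simp: span_singleton_iff)
    then show ?thesis by (auto simp: h_def vector_scalar_commute inv)
  qed
  have Fq01: "(0::'a) \<in> Fq q" "(1::'a) \<in> Fq q" by (auto simp: Fq_iff)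
  have "\<exists>c. h (axis i 1) = c *s axis i 1" for i
    by (rule h_fix) (use Fq01 in \<open>auto simp: axis_def vec_eq_iff\<close>)
  then obtain d where d: "\<And>i. h (axis i 1) = d i *s axis i 1" by metis
  have h_expand: "h v $ i = \<eta> (v $ i) * d i" for v i
  proof -
    have "h v = h (\<Sum>j\<in>UNIV. v $ j *s axis j 1)" by (simp add: basis_expansion)
    also have "\<dots> = (\<Sum>j\<in>UNIV. (\<eta> (v $ j) * d j) *s axis j 1)" by (simp add: h_sum h_scale d)
    finally have "h v $ i = (\<Sum>j\<in>UNIV. (\<eta> (v $ j) * d j) * axis j 1 $ i)" by simp
    also have "\<dots> = (\<Sum>j\<in>UNIV. if j = i then \<eta> (v $ j) * d j else 0)"
      by (intro sum.cong refl) (auto simp: axis_def)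
    also have "\<dots> = \<eta> (v $ i) * d i" by simp
    finally show ?thesis .
  qed
  have "\<exists>c. h (\<chi> i. 1) = c *s (\<chi> i. 1)"
    by (rule h_fix) (use Fq01 in \<open>auto simp: vec_eq_iff\<close>)
  then obtain c where "h (\<chi> i. 1) = c *s (\<chi> i. 1)" by blast
  then have d_c: "d i = c" for i
    using h_expand[of "\<chi> i. 1" i] by (simp add: \<eta>_simps)
  have c: "c \<noteq> 0"
  proof
    assume "c = 0"
    then have "h (axis 1 1) = 0" using d d_c by simp
    then have "M *v (M' *v f (M *v axis 1 1)) = 0" by (simp add: h_def)
    then have "f (M *v axis 1 1) = f 0" using \<eta>(2)[of 0 0] by (simp add: inv \<eta>_simps)
    then have "M *v axis 1 1 = 0" using inj_eq[OF bij_is_inj[OF f_bij]] by blast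
    then have "M' *v (M *v axis 1 1) = 0" by simp
    then have "axis 1 (1::'a) $ (1::5) = 0" by (simp add: inv)
    then show False by simp
  qed
  have fix_Fq: "\<eta> x = x" if "x \<in> Fq q" for x
  proof -
    \<comment> \<open>The first coordinate reads off the factor, the second then gives
      \<open>\<eta> x = x\<close>.\<close>
    let ?v = "(\<chi> i. if i = 1 then 1 else x) :: 'a ^ 5"
    have "\<exists>e. h ?v = e *s ?v"
    proof (rule h_fix)
      have "?v $ 1 \<noteq> 0" by simp
      then show "?v \<noteq> 0" by (metis zero_index)
    qed (use Fq01 that in auto)
    then obtain e where e: "h ?v = e *s ?v" by blast
    have "h ?v $ 1 = e" "h ?v $ 2 = e * x" unfolding e by simp_all
    then show ?thesis using h_expand[of ?v 1] h_expand[of ?v 2] c by (simp add: d_c \<eta>_simps mult.commute)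
  qed
  obtain m where m: "m < 5" "\<eta> = fr m"
    by (rule automorphism_is_fr[of \<eta>]) (use fix_Fq in \<open>auto simp: \<eta>_simps\<close>)
  have "f v = c *s conj_fr M M' m v" for v
  proof -
    have "f v = M *v h (M' *v v)" by (simp add: h_def inv)
    also have "h (M' *v v) = c *s (\<chi> i. fr m ((M' *v v) $ i))"
      by (simp add: vec_eq_iff h_expand d_c m(2) mult.commute)
    finally show ?thesis by (simp add: conj_fr_def vector_scalar_commute)
  qed
  then show ?thesis using that m(1) c by blast
qed

end

theorem theorem2p10:
  fixes q :: nat
    and S \<Gamma> \<Lambda> :: "('a::{field,finite} ^ 5) set set"
    and \<kappa> :: "('a ^ 5) set \<Rightarrow> ('a ^ 2) set"
    and L :: "('a ^ 2) set set"
    and \<sigma> :: "('a ^ 5) set \<Rightarrow> ('a ^ 5) set"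
    and A B E F :: "('a ^ 5) set"
  assumes "primepow q" and "CARD('a) = q ^ 5"
    and "canonical_subgeometry q S"
    and "pg_plane \<Gamma>" and "\<Gamma> \<inter> S = {}"
    and "pg_line \<Lambda>" and "\<Lambda> \<inter> \<Gamma> = {}"
    and "pg_coordinates \<Lambda> \<kappa>"
    and "L = \<kappa> ` pg_projection \<Gamma> \<Lambda> S"
    and "maximum_scattered q L"
    and "\<not> pseudoregulus_type q L"
    and "\<sigma> \<in> pointwise_stabilizer S" and "\<sigma> \<noteq> pg_one"
    and "\<Gamma> \<inter> (\<sigma> ^^ 4) ` \<Gamma> = {A}"
    and "\<Gamma> \<inter> (\<sigma> ^^ 3) ` \<Gamma> = {B}"
    and "pg_span {A, B} \<inter> pg_span {\<sigma> A, (\<sigma> ^^ 2) B} = {E}"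
    and "pg_span {A, (\<sigma> ^^ 2) B} \<inter> pg_span {\<sigma> A, B} = {F}"
  shows "LP_type q L \<longleftrightarrow>
           E \<in> pg_span {(\<sigma> ^^ 2) A, (\<sigma> ^^ 4) A} \<or> F \<in> pg_span {(\<sigma> ^^ 3) B, (\<sigma> ^^ 4) B}"
proof -
  interpret quintic_field q "TYPE('a)" by unfold_locales fact+
  obtain M :: "'a ^ 5 ^ 5" where M: "invertible M"
    "S = (\<lambda>P\<in>pg_points. (\<lambda>v. M *v v) ` P) ` {vec.span {v} | v. v \<noteq> 0 \<and> (\<forall>i. v $ i \<in> Fq q)}"
    using assms(3) unfolding canonical_subgeometry_def PGL_def by blast
  obtain M' where MM': "M ** M' = mat 1" "M' ** M = mat 1"
    using M(1) unfolding invertible_def by blast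
  have inv: "M *v (M' *v w) = w" "M' *v (M *v w) = w" for w
    using MM' by (simp_all add: matrix_vector_mul_assoc)
  let ?T = "conj_fr M M'"
  have S: "S = {vec.span {v} | v. ?T 1 v = v \<and> v \<noteq> 0}"
  proof (intro equalityI subsetI)
    fix P assume "P \<in> S"
    then obtain v where v: "v \<noteq> 0" "\<And>i. v $ i \<in> Fq q" "P = vec.span {M *v v}"
      unfolding M(2) by (auto simp: pg_point_iff image_matrix_span_singleton)
    have "M *v v \<noteq> 0" using v(1) inv(2)[of v] by (metis matrix_vector_mult_0_right)
    then show "P \<in> {vec.span {v} | v. ?T 1 v = v \<and> v \<noteq> 0}"
      using v(2,3) unfolding conj_fr_fixed_iff[OF MM'] by (auto simp: inv intro!: exI[of _ "M *v v"])
  next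
    fix P assume "P \<in> {vec.span {v} | v. ?T 1 v = v \<and> v \<noteq> 0}"
    then obtain v where v: "v \<noteq> 0" "\<And>i. (M' *v v) $ i \<in> Fq q" "P = vec.span {v}"
      unfolding conj_fr_fixed_iff[OF MM'] by blast
    have nz: "M' *v v \<noteq> 0" using v(1) inv(1)[of v] by (metis matrix_vector_mult_0_right)
    then have "P = (\<lambda>P\<in>pg_points. (\<lambda>v. M *v v) ` P) (vec.span {M' *v v})"
      by (simp add: pg_point_iff image_matrix_span_singleton inv v(3))
    then show "P \<in> S" unfolding M(2) using nz v(2) by blast
  qed
  obtain W where W: "vec.subspace W" "vec.dim W = 3" "\<Gamma> = {P \<in> pg_points. P \<subseteq> W}"
    using assms(4) unfolding pg_subspace_def by auto
  obtain W' where W': "vec.subspace W'" "vec.dim W' = 2" "\<Lambda> = {P \<in> pg_points. P \<subseteq> W'}"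
    using assms(6) unfolding pg_subspace_def by auto
  have \<Gamma>_iff: "vec.span {v} \<in> \<Gamma> \<longleftrightarrow> v \<noteq> 0 \<and> v \<in> W" for v
    using span_singleton_subset_iff[OF W(1)] by (auto simp: W(3) pg_point_iff)
  have \<Lambda>_iff: "vec.span {v} \<in> \<Lambda> \<longleftrightarrow> v \<noteq> 0 \<and> v \<in> W'" for v
    using span_singleton_subset_iff[OF W'(1)] by (auto simp: W'(3) pg_point_iff)
  have WW': "W \<inter> W' = {0}"
  proof -
    have "v = 0" if "v \<in> W" "v \<in> W'" for v
      using that \<Gamma>_iff[of v] \<Lambda>_iff[of v] assms(7) by blast
    then show ?thesis using vec.subspace_0[OF W(1)] vec.subspace_0[OF W'(1)] by blast
  qed
  have dim: "vec.dim W + vec.dim W' = CARD(5)" using W(2) W'(2) by simp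
  obtain pr where pr: "\<And>u v. pr (u + v) = pr u + pr v" "\<And>c v. pr (c *s v) = c *s pr v"
    "\<And>v. pr v \<in> W'" "\<And>v. v - pr v \<in> W" "\<And>v. v \<in> W \<Longrightarrow> pr v = 0" "\<And>v. v \<in> W' \<Longrightarrow> pr v = v"
    by (rule complement_projection[OF W(1) W'(1) dim WW']) (rule that)
  obtain C :: "'a ^ 5 ^ 2" where "inj_on (\<lambda>v. C *v v) (vec.span (\<Union>\<Lambda>)) \<and>
      (\<forall>P\<in>\<Lambda>. \<kappa> P = (\<lambda>v. C *v v) ` P)"
    using assms(8) unfolding pg_coordinates_def by (elim conjE exE) (rule that, rule conjI)
  then have C: "inj_on (\<lambda>v. C *v v) (vec.span (\<Union>\<Lambda>))"
    "\<And>P. P \<in> \<Lambda> \<Longrightarrow> \<kappa> P = (\<lambda>v. C *v v) ` P" by auto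
  \<comment> \<open>Projection from \<Gamma> onto \<Lambda> followed by the coordinates \<kappa>,
    which are injective on \<Lambda>, so the kernel is \<open>W\<close>.\<close>
  define N where "N v = C *v pr v" for v
  have N_add: "N (u + v) = N u + N v" and N_scale: "N (c *s v) = c *s N v" for u v c
    by (simp_all add: N_def pr matrix_vector_right_distrib vector_scalar_commute)
  have W'_span: "v \<in> vec.span (\<Union>\<Lambda>)" if "v \<in> W'" for v
  proof (cases "v = 0")
    case False
    then have "vec.span {v} \<in> \<Lambda>" using that \<Lambda>_iff by blast
    then show ?thesis using vec.span_base[of v "{v}"] by (intro vec.span_base) blast
  qed (simp add: vec.span_zero)
  have N_0_iff: "N v = 0 \<longleftrightarrow> v \<in> W" for v
  proof
    assume "N v = 0"
    then have "C *v pr v = C *v 0" by (simp add: N_def)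
    then have "pr v = 0"
      using inj_onD[OF C(1)] W'_span[OF pr(3)] vec.span_zero by blast
    then show "v \<in> W" using pr(4)[of v] by simp
  qed (simp add: N_def pr(5))
  have N_nz: "N v \<noteq> 0" if "?T 1 v = v" "v \<noteq> 0" for v
  proof
    assume "N v = 0"
    then have "vec.span {v} \<in> \<Gamma> \<inter> S" using that \<Gamma>_iff[of v] N_0_iff unfolding S by blast
    then show False using assms(5) by blast
  qed
  \<comment> \<open>Modulo \<open>W\<close>, a vector of the solid spanned by the point and \<Gamma>
    is a multiple of \<open>v\<close>, so \<open>pr\<close> maps it to a multiple of
    \<open>pr v\<close>.\<close>
  have project: "pg_span (insert (vec.span {v}) \<Gamma>) \<inter> \<Lambda> = {vec.span {pr v}}" if "N v \<noteq> 0" for v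
  proof (intro equalityI subsetI)
    have prv: "pr v \<noteq> 0" using that by (auto simp: N_def)
    fix Q
    {
      assume "Q \<in> pg_span (insert (vec.span {v}) \<Gamma>) \<inter> \<Lambda>"
      moreover from this obtain w where w: "w \<noteq> 0" "Q = vec.span {w}"
        by (auto simp: pg_span_def elim: pg_pointE)
      ultimately have Q: "w \<in> vec.span (vec.span {v} \<union> \<Union>\<Gamma>)" "w \<in> W'"
        by (auto simp: pg_span_def \<Lambda>_iff span_singleton_subset_iff)
      have "\<Union>\<Gamma> \<subseteq> W" by (auto simp: W(3))
      then have "vec.span (\<Union>\<Gamma>) \<subseteq> W" using W(1) by (rule vec.span_minimal)
      then obtain c y where cy: "w = c *s v + y" "y \<in> W"
        using Q(1) by (auto simp: vec.span_Un vec.span_span span_singleton_iff)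
      then have "w = c *s pr v" using pr(6)[OF Q(2)] by (simp add: pr(1,2,5))
      then show "Q \<in> {vec.span {pr v}}" using w by (auto simp: span_singleton_scale)
    }
    {
      assume "Q \<in> {vec.span {pr v}}"
      then have Q: "Q = vec.span {pr v}" by simp
      let ?X = "vec.span {v} \<union> \<Union>\<Gamma>"
      have "v \<in> vec.span ?X" using vec.span_base[of v "{v}"] by (intro vec.span_base) blast
      moreover have "v - pr v \<in> vec.span ?X"
      proof (cases "v - pr v = 0")
        case False
        then have "vec.span {v - pr v} \<in> \<Gamma>" using pr(4) \<Gamma>_iff by blast
        then show ?thesis using vec.span_base[of "v - pr v" "{v - pr v}"] by (intro vec.span_base) blast
      qed (simp add: vec.span_zero)
      ultimately have "v - (v - pr v) \<in> vec.span ?X" by (rule vec.span_diff)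
      then show "Q \<in> pg_span (insert (vec.span {v}) \<Gamma>) \<inter> \<Lambda>"
        using prv pr(3) by (simp add: Q pg_span_def \<Lambda>_iff pg_point_iff span_singleton_subset_iff)
    }
  qed
  have L: "L = {vec.span {N v} | v. ?T 1 v = v \<and> v \<noteq> 0}"
  proof -
    have "pg_projection \<Gamma> \<Lambda> S = {vec.span {pr v} | v. ?T 1 v = v \<and> v \<noteq> 0}"
    proof (intro equalityI subsetI)
      fix Q assume "Q \<in> pg_projection \<Gamma> \<Lambda> S"
      then obtain v where v: "?T 1 v = v" "v \<noteq> 0" "pg_span (insert (vec.span {v}) \<Gamma>) \<inter> \<Lambda> = {Q}"
        unfolding pg_projection_def S by blast
      then have "Q = vec.span {pr v}" using project[OF N_nz[OF v(1,2)]] by simp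
      then show "Q \<in> {vec.span {pr v} | v. ?T 1 v = v \<and> v \<noteq> 0}" using v(1,2) by blast
    next
      fix Q assume "Q \<in> {vec.span {pr v} | v. ?T 1 v = v \<and> v \<noteq> 0}"
      then obtain v where v: "?T 1 v = v" "v \<noteq> 0" "Q = vec.span {pr v}" by blast
      then have "vec.span {v} \<in> S" unfolding S by blast
      then show "Q \<in> pg_projection \<Gamma> \<Lambda> S"
        unfolding pg_projection_def using project[OF N_nz[OF v(1,2)]] v(3) by blast
    qed
    moreover have "\<kappa> (vec.span {pr v}) = vec.span {N v}" if "?T 1 v = v" "v \<noteq> 0" for v
    proof -
      have "pr v \<noteq> 0" using N_nz[OF that] by (auto simp: N_def)
      then have "vec.span {pr v} \<in> \<Lambda>" using pr(3) \<Lambda>_iff by blast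
      then show ?thesis by (simp add: C(2) image_matrix_span_singleton N_def)
    qed
    ultimately show ?thesis unfolding assms(9) by (auto simp: image_iff) blast+
  qed
  interpret scattered_projection q "TYPE('a)" ?T N
  proof (rule scattered_projection_conj_fr[OF MM' N_add N_scale N_nz])
    show "card {vec.span {N v} | v. ?T 1 v = v \<and> v \<noteq> 0} = (q ^ 5 - 1) div (q - 1)"
      using assms(10) unfolding L maximum_scattered_def by blast
  qed
  have L_eq: "L = line_set" unfolding L line_set_def fixed_def by simp
  have \<Gamma>_eq: "\<Gamma> = plane" by (simp add: W(3) plane_def N_0_iff)
  obtain f where f: "semilinear_bij f" "\<sigma> = (\<lambda>P\<in>pg_points. f ` P)"
    and \<sigma>_S: "\<And>P. P \<in> S \<Longrightarrow> \<sigma> P = P"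
    using assms(12) unfolding pointwise_stabilizer_def PGammaL_def by blast
  have f_fix: "f ` vec.span {M *v v} = vec.span {M *v v}" if v: "v \<noteq> 0" "\<And>i. v $ i \<in> Fq q" for v
  proof -
    have "M *v v \<noteq> 0" using v(1) inv(2)[of v] by (metis matrix_vector_mult_0_right)
    moreover have "?T 1 (M *v v) = M *v v" unfolding conj_fr_fixed_iff[OF MM'] using v(2) by (simp add: inv)
    ultimately have "vec.span {M *v v} \<in> S" unfolding S by blast
    then have "\<sigma> (vec.span {M *v v}) = vec.span {M *v v}" by (rule \<sigma>_S)
    then show ?thesis using \<open>M *v v \<noteq> 0\<close> by (simp add: f(2) pg_point_iff)
  qed
  obtain m c where m: "m < 5" "c \<noteq> 0" "\<And>v. f v = c *s ?T m v"
  proof (rule collineation_fixing_subgeometry[OF MM' f(1)])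
    show "f ` vec.span {M *v v} = vec.span {M *v v}" if "v \<noteq> 0" "\<And>i. v $ i \<in> Fq q" for v
      using that by (rule f_fix)
  qed (rule that)
  have \<sigma>: "\<sigma> P = ?T m ` P" if P: "P \<in> pg_points" for P
  proof -
    obtain v where v: "v \<noteq> 0" "P = vec.span {v}" using pg_pointE[OF P] .
    obtain \<eta> where \<eta>: "\<And>c v. f (c *s v) = \<eta> c *s f v" "surj \<eta>"
      using f(1) unfolding semilinear_bij_def field_automorphism_def bij_def by blast
    have "\<sigma> P = vec.span {f v}" using P image_span_singleton[of f \<eta> v, OF \<eta>] by (simp add: f(2) v(2))
    also have "\<dots> = vec.span {?T m v}" by (simp add: m(2,3) span_singleton_scale)
    finally show ?thesis by (simp add: T_image_span v(2))
  qed
  \<comment> \<open>Both \<open>\<sigma>\<close> and \<open>pg_one\<close> are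
    \<open>undefined\<close> off the points, so agreement on points would make them equal.\<close>
  have "m \<noteq> 0"
  proof
    assume "m = 0"
    then have "\<sigma> = pg_one" using \<sigma> f(2) by (auto simp: pg_one_def fun_eq_iff restrict_def)
    then show False using assms(13) by blast
  qed
  then have m5: "\<not> 5 dvd m" using m(1) by (auto dest: dvd_imp_le)
  have \<sigma>_pow: "(\<sigma> ^^ k) P = ?T (k * m) ` P" if "P \<in> pg_points" for k P
  proof (induction k)
    case (Suc k)
    have "?T (k * m) ` P \<in> pg_points" using that by (rule T_image_pg_point)
    then show ?case using Suc by (simp add: \<sigma> T_image_T_image)
  qed simp
  have plane_pts: "P \<in> pg_points" if "P \<in> plane" for P using that by (simp add: plane_def)
  have \<sigma>_plane: "(\<sigma> ^^ k) ` plane = (`) (?T (k * m)) ` plane" for k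
    by (intro image_cong refl) (simp add: \<sigma>_pow plane_pts)
  have "A \<in> \<Gamma> \<inter> (\<sigma> ^^ 4) ` \<Gamma>" "B \<in> \<Gamma> \<inter> (\<sigma> ^^ 3) ` \<Gamma>" unfolding assms(14,15) by simp_all
  then have pts: "A \<in> pg_points" "B \<in> pg_points" unfolding \<Gamma>_eq by (simp_all add: plane_pts)
  note \<sigma>_AB = \<sigma>[OF pts(1)] \<sigma>_pow[OF pts(1)] \<sigma>_pow[OF pts(2)]
  show ?thesis
    unfolding L_eq \<sigma>_AB
    by (rule LP_type_iff_diagonal_points[OF m5])
      (use assms(14-17) in \<open>simp_all add: \<sigma>_AB \<sigma>_plane \<Gamma>_eq\<close>)
qed

end
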